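(* Let $n\ge2$ be an integer, let $\rho:[0,2\pi]\to\mathbb{R}^+$ be a probability density on $[0,2\pi]$, and let $K^{(\rho)}$ be the Markov transition kernel on $SO(n)$ given by $$K^{(\rho)}_x(S)=\frac{1}{\binom{n}{2}}\sum_{1\le i<j\le n}\int_0^{2\pi}\delta_{R(i,j,\theta)x}(S)\,\rho(\theta)\,d\theta,\qquad x\in SO(n),\ S\subset SO(n)\text{ Borel}.$$ Suppose that $$\rho_{\min}=\min_{\theta\in[0,2\pi]}\rho(\theta)>0.$$ Then the $L^2$ transportation-cost mixing time $$\tau_{D,2}(\varepsilon)=\inf\{t\in\mathbb{N}: W_{D,2}(\mu (K^{(\rho)})^t,\mathcal{H})\le\varepsilon \text{ for all Borel probability measures } \mu \text{ on } SO(n)\}$$ of $K^{(\rho)}$ satisfies $$\tau_{D,2}(\varepsilon)\le\left\lceil\frac{n^2}{2\pi\rho_{\min}}\ln\left(\frac{\pi\sqrt n}{\varepsilon}\right)\right\rceil,\qquad \varepsilon>0 .$$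
   Context: $\mathbb{N}=\{0,1,2,\dots\}$. $M(n,\mathbb{R})$ is the space of real $n\times n$ matrices with the Hilbert–Schmidt inner product $\langle a,b\rangle_{\mathrm{hs}}=\mathrm{Tr}(a^\dagger b)$, where $a^\dagger$ is the transpose. $SO(n)=\{a\in M(n,\mathbb{R}): aa^\dagger=\mathrm{id},\ \det a=1\}$, and $D$ is the Riemannian distance on the submanifold $SO(n)$ for the Riemannian structure obtained by restricting $\langle\cdot,\cdot\rangle_{\mathrm{hs}}$ to its tangent spaces (so $D(a,b)$ is the infimum of the Hilbert–Schmidt lengths of piecewise smooth curves in $SO(n)$ from $a$ to $b$). $\mathcal{H}$ is the unique bi-invariant (Haar) Borel probability measure on $SO(n)$. For $1\le i<j\le n$ and $\theta\in[0,2\pi]$, $R(i,j,\theta)\in SO(n)$ is the linear map with $R(i,j,\theta)e_i=\cos\theta\, e_i+\sin\theta\, e_j$, $R(i,j,\theta)e_j=\cos\theta\, e_j-\sin\theta\, e_i$, and $R(i,j,\theta)e_k=e_k$ for $k\notin\{i,j\}$, where $e_1,\dots,e_n$ is the canonical basis of $\mathbb{R}^n$. For a kernel $P$ and a probability measure $\mu$, $\mu P(S)=\int P_x(S)\,d\mu(x)$, $\mu P^0=\mu$ and $\mu P^{t+1}=(\mu P^t)P$. For a metric space $(M,d)$ and Borel probability measures $\mu,\nu$ on $M$ with finite second moments, $W_{d,2}(\mu,\nu)=\inf\left(\int d(x,y)^2\,d\eta(x,y)\right)^{1/2}$, the infimum being over all couplings $\eta$ of $\mu$ and $\nu$ (probability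 measures on $M\times M$ with marginals $\mu,\nu$).
   Formalization: The bound is proved with the ceiling replaced by max(0, ceiling): for ε so large that the ceiling is negative, the inequality as written fails because the mixing time is a natural number; for all other ε the bound is as stated. *)

theory Defs
  imports "HOL-Probability.Probability"
begin

definition hs_inner :: "real^'n^'n \<Rightarrow> real^'n^'n \<Rightarrow> real" where
  "hs_inner a b = trace (transpose a ** b)"

lemma hs_inner_eq_inner: "hs_inner a b = inner a b"
  unfolding hs_inner_def trace_def transpose_def matrix_matrix_mult_def inner_vec_def
  by (simp, subst sum.swap, rule refl)

definition SO :: "(real^'n^'n) set" where
  "SO = {a. a ** transpose a = mat 1 \<and> det a = 1}"

lemma SO_eq_rotation_matrix: "SO = {a. rotation_matrix a}"
  by (auto simp: SO_def rotation_matrix_def orthogonal_matrix_def matrix_left_right_inverse)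

definition borel_SO :: "(real^'n^'n) measure" where
  "borel_SO = restrict_space borel SO"

definition borel_prob :: "(real^'n^'n) measure \<Rightarrow> bool" where
  "borel_prob \<mu> \<longleftrightarrow> sets \<mu> = sets borel_SO \<and> prob_space \<mu>"

definition haar_prob :: "(real^'n^'n) measure \<Rightarrow> bool" where
  "haar_prob H \<longleftrightarrow> borel_prob H \<and>
     (\<forall>a\<in>SO. distr H borel_SO (\<lambda>x. a ** x) = H \<and> distr H borel_SO (\<lambda>x. x ** a) = H)"


text \<open>Derivatives at the end points of \<open>[a, b]\<close> are one-sided, so that on each of its pieces
  a piecewise smooth curve is smooth up to the break points. The weaker notion
  \<open>valid_path\<close> would admit curves of infinite length, to which \<open>integral\<close> assigns length 0.\<close>

definition smooth_on_Icc :: "(real \<Rightarrow> 'a::real_normed_vector) \<Rightarrow> real \<Rightarrow> real \<Rightarrow> bool" where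
  "smooth_on_Icc \<gamma> a b \<longleftrightarrow>
     (\<exists>g :: nat \<Rightarrow> real \<Rightarrow> 'a. g 0 = \<gamma> \<and>
        (\<forall>k. \<forall>t\<in>{a..b}. (g k has_vector_derivative g (Suc k) t) (at t within {a..b})))"

definition piecewise_smooth :: "(real \<Rightarrow> 'a::real_normed_vector) \<Rightarrow> bool" where
  "piecewise_smooth \<gamma> \<longleftrightarrow>
     (\<exists>(N::nat) s. s 0 = 0 \<and> s N = 1 \<and>
        (\<forall>k<N. s k < s (Suc k) \<and> smooth_on_Icc \<gamma> (s k) (s (Suc k))))"

definition hs_length :: "(real \<Rightarrow> real^'n^'n) \<Rightarrow> real" where
  "hs_length \<gamma> = integral {0..1}
     (\<lambda>t. let v = vector_derivative \<gamma> (at t within {0..1}) in sqrt (hs_inner v v))"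

definition riem_dist :: "real^'n^'n \<Rightarrow> real^'n^'n \<Rightarrow> real" where
  "riem_dist a b = Inf {hs_length \<gamma> | \<gamma>.
     piecewise_smooth \<gamma> \<and> \<gamma> ` {0..1} \<subseteq> SO \<and> \<gamma> 0 = a \<and> \<gamma> 1 = b}"


definition couplings :: "'a measure \<Rightarrow> 'a measure \<Rightarrow> ('a \<times> 'a) measure set" where
  "couplings \<mu> \<nu> = {\<eta>. sets \<eta> = sets (\<mu> \<Otimes>\<^sub>M \<nu>) \<and> prob_space \<eta> \<and>
     distr \<eta> \<mu> fst = \<mu> \<and> distr \<eta> \<nu> snd = \<nu>}"

text \<open>For measures with finite second moments on a separable metric space the cost is integrable
  under every coupling, so the value 0 of the Bochner integral for non-integrable functions
  plays no role.\<close>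

definition wasserstein2 :: "('a \<Rightarrow> 'a \<Rightarrow> real) \<Rightarrow> 'a measure \<Rightarrow> 'a measure \<Rightarrow> real" where
  "wasserstein2 d \<mu> \<nu> = (INF \<eta>\<in>couplings \<mu> \<nu>. sqrt (\<integral>z. (d (fst z) (snd z))\<^sup>2 \<partial>\<eta>))"


text \<open>The argument of the outer \<open>$\<close> is the image of the basis vector \<open>axis c 1\<close>,
  that is, the \<open>c\<close>-th column.\<close>

definition rot :: "'n \<Rightarrow> 'n \<Rightarrow> real \<Rightarrow> real^'n^'n" where
  "rot i j \<theta> = (\<chi> r c.
     (if c = i then cos \<theta> *\<^sub>R axis i 1 + sin \<theta> *\<^sub>R axis j 1
      else if c = j then cos \<theta> *\<^sub>R axis j 1 - sin \<theta> *\<^sub>R axis i 1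
      else axis c 1) $ r)"

lemma rot_axis:
  assumes "i \<noteq> j"
  shows "rot i j \<theta> *v axis i 1 = cos \<theta> *\<^sub>R axis i 1 + sin \<theta> *\<^sub>R axis j 1"
    and "rot i j \<theta> *v axis j 1 = cos \<theta> *\<^sub>R axis j 1 - sin \<theta> *\<^sub>R axis i 1"
    and "k \<notin> {i, j} \<Longrightarrow> rot i j \<theta> *v axis k 1 = axis k 1"
  using assms by (auto simp: vec_eq_iff matrix_vector_mul_component matrix_vector_mult_basis column_def rot_def)

definition prob_density_2pi :: "(real \<Rightarrow> real) \<Rightarrow> bool" where
  "prob_density_2pi \<rho> \<longleftrightarrow> (\<forall>\<theta>\<in>{0..2*pi}. 0 \<le> \<rho> \<theta>) \<and>
     set_integrable lborel {0..2*pi} \<rho> \<and> (LINT \<theta>:{0..2*pi}|lborel. \<rho> \<theta>) = 1"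

definition kac_kernel ::
  "(real \<Rightarrow> real) \<Rightarrow> real^'n::{finite,linorder}^'n::_ \<Rightarrow> (real^'n::_^'n::_) measure" where
  "kac_kernel \<rho> x = measure_of SO (sets borel_SO)
     (\<lambda>S. (\<Sum>(i, j)\<in>{(i, j). i < j}.
             \<integral>\<^sup>+\<theta>\<in>{0..2*pi}. indicator S (rot i j \<theta> ** x) * ennreal (\<rho> \<theta>) \<partial>lborel)
          / of_nat (CARD('n) choose 2))"

lemma borel_SO_sets_borel: "S \<in> sets borel_SO \<Longrightarrow> S \<in> sets borel"
proof -
  have "continuous_on UNIV (\<lambda>a::real^'n^'n. a ** transpose a)"
    unfolding matrix_matrix_mult_def transpose_def by (intro continuous_intros)
  moreover have "continuous_on UNIV (\<lambda>a::real^'n^'n. det a)"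
    unfolding det_def by (intro continuous_intros)
  ultimately have "closed (SO :: (real^'n^'n) set)"
    unfolding SO_def Collect_conj_eq
    by (intro closed_Int closed_Collect_eq continuous_intros)
  then have "SO \<in> sets (borel :: (real^'n^'n) measure)"
    by (rule borel_closed)
  then show "S \<in> sets borel_SO \<Longrightarrow> S \<in> sets borel"
    by (auto simp: borel_SO_def sets_restrict_space)
qed

lemma emeasure_kac_kernel:
  fixes x :: "real^'n::{finite,linorder}^'n::_"
  assumes \<rho>: "prob_density_2pi \<rho>" and S: "S \<in> sets borel_SO"
  shows "emeasure (kac_kernel \<rho> x) S =
    (\<Sum>(i, j)\<in>{(i, j). i < j}.
       \<integral>\<^sup>+\<theta>\<in>{0..2*pi}. indicator S (rot i j \<theta> ** x) * ennreal (\<rho> \<theta>) \<partial>lborel)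
    / of_nat (CARD('n) choose 2)"
proof -
  let ?f = "\<lambda>i j S \<theta>. indicator S (rot i j \<theta> ** x) * ennreal (\<rho> \<theta>) * indicator {0..2*pi} \<theta> :: ennreal"
  have meas: "?f i j S \<in> borel_measurable lborel" if "S \<in> sets borel_SO" for i j S
  proof -
    have "continuous_on UNIV (\<lambda>\<theta>.
        if c = i then cos \<theta> *\<^sub>R axis i 1 + sin \<theta> *\<^sub>R axis j 1
        else if c = j then cos \<theta> *\<^sub>R axis j 1 - sin \<theta> *\<^sub>R axis i 1
        else axis c 1 :: real^'n::_)" for c
      by (cases "c = i"; cases "c = j") (auto intro!: continuous_intros)
    then have "continuous_on UNIV (\<lambda>\<theta>. rot i j \<theta> ** x)"
      unfolding matrix_matrix_mult_def rot_def
      by (intro continuous_intros)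
    then have r: "(\<lambda>\<theta>. rot i j \<theta> ** x) \<in> borel_measurable lborel"
      using borel_measurable_continuous_onI by auto
    have "(\<lambda>\<theta>. indicator {0..2*pi} \<theta> *\<^sub>R \<rho> \<theta>) \<in> borel_measurable lborel"
      using \<rho> unfolding prob_density_2pi_def set_integrable_def by auto
    then have "(\<lambda>\<theta>. indicator S (rot i j \<theta> ** x) * ennreal (indicator {0..2*pi} \<theta> *\<^sub>R \<rho> \<theta>))
        \<in> borel_measurable lborel"
      using r borel_SO_sets_borel[OF that] by measurable
    moreover have "indicator S (rot i j \<theta> ** x) * ennreal (indicator {0..2*pi} \<theta> *\<^sub>R \<rho> \<theta>) = ?f i j S \<theta>" for \<theta>
      by (auto split: split_indicator)
    ultimately show ?thesis by simp
  qed
  let ?\<mu> = "\<lambda>S. (\<Sum>(i, j)\<in>{(i, j). i < j}. \<integral>\<^sup>+\<theta>. ?f i j S \<theta> \<partial>lborel) / of_nat (CARD('n) choose 2)"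
  have "countably_additive (sets borel_SO) ?\<mu>"
  proof (rule countably_additiveI)
    fix A :: "nat \<Rightarrow> (real^'n::_^'n::_) set"
    assume A: "range A \<subseteq> sets borel_SO" "disjoint_family A"
    have f: "(\<integral>\<^sup>+\<theta>. ?f i j (\<Union>k. A k) \<theta> \<partial>lborel) = (\<Sum>k. \<integral>\<^sup>+\<theta>. ?f i j (A k) \<theta> \<partial>lborel)" for i j
      using A meas
      by (subst nn_integral_suminf[symmetric])
         (auto simp: suminf_indicator[symmetric] mult.assoc)
    show "(\<Sum>k. ?\<mu> (A k)) = ?\<mu> (\<Union>k. A k)"
      by (simp add: f divide_ennreal_def case_prod_unfold suminf_sum[symmetric])
  qed
  moreover have "positive (sets borel_SO) ?\<mu>"
    by (simp add: positive_def)
  moreover have "sigma_algebra SO (sets borel_SO)"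
    using sets.sigma_algebra_axioms[of borel_SO] by (simp add: borel_SO_def space_restrict_space)
  ultimately show ?thesis
    unfolding kac_kernel_def using S by (intro emeasure_measure_of_sigma)
qed

primrec kernel_iter :: "'a measure \<Rightarrow> ('a \<Rightarrow> 'a measure) \<Rightarrow> nat \<Rightarrow> 'a measure" where
  "kernel_iter \<mu> P 0 = \<mu>"
| "kernel_iter \<mu> P (Suc t) = kernel_iter \<mu> P t \<bind> P"

text \<open>The type \<open>enat\<close> is used so that the infimum of the empty set is \<open>\<infinity>\<close>.\<close>

definition mixing_time ::
  "(real^'n^'n \<Rightarrow> (real^'n^'n) measure) \<Rightarrow> (real^'n^'n) measure \<Rightarrow> real \<Rightarrow> enat" where
  "mixing_time P H \<epsilon> = Inf {enat t | t. \<forall>\<mu>. borel_prob \<mu> \<longrightarrow>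
     wasserstein2 riem_dist (kernel_iter \<mu> P t) H \<le> \<epsilon>}"

end

theory Submission
  imports Defs
begin

text \<open>
  The coupling of the walk with the Haar measure carries along a whole random smooth curve
  \<open>\<gamma>\<close> in \<open>SO(n)\<close> that joins the two copies; if \<open>\<gamma>' = B \<gamma>\<close> with \<open>B\<close> skew, the squared distance of
  the end points is at most the energy \<open>\<integral> |B|\<^sup>2\<close>. If the walk applies \<open>R(i, j, \<theta>)\<close> to the first copy,
  the point \<open>\<gamma>(s)\<close> is moved by \<open>R(i, j, \<theta> - \<delta>(s))\<close> with \<open>\<delta>(s) = \<integral>\<^sub>0\<^sup>s B\<^sub>j\<^sub>i\<close>. This removes the \<open>(i, j)\<close>
  component from \<open>B\<close>, hence \<open>2 \<integral> B\<^sub>j\<^sub>i\<^sup>2\<close> from the energy, and because a uniform angle stays uniform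
  under the shift, the second copy still performs the walk when \<open>\<theta>\<close> comes from the uniform part
  \<open>\<rho>min\<close> of \<open>\<rho>\<close>; for the remaining part of \<open>\<rho>\<close> no shift is made. Averaging over \<open>i < j\<close>
  contracts the expected energy by \<open>1 - 2 \<pi> \<rho>min / (n choose 2)\<close>. No minimal geodesic and no
  measurable choice of one is needed.

  For the initial curve, a rotation \<open>u\<close> is written as a product of \<open>n - 1\<close> plane rotations by angles
  \<open>\<phi>\<^sub>k\<close>, the \<open>k\<close>-th of which brings the \<open>k\<close>-th basis vector to its place. Turning all of them
  simultaneously gives a curve of energy \<open>\<Sum> 2 \<phi>\<^sub>k\<^sup>2\<close>, since the successive velocities are
  orthogonal. Changing the sign of two columns of \<open>u\<close> replaces \<open>\<phi>\<^sub>k\<close> by \<open>\<pi> - \<phi>\<^sub>k\<close>, so under the Haar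
  measure the mean of \<open>\<phi>\<^sub>k\<^sup>2\<close> is at most \<open>\<pi>\<^sup>2 / 2\<close> and the mean energy at most \<open>\<pi>\<^sup>2 n\<close>.
\<close>

subsection \<open>Rotations in a plane\<close>

definition outer :: "real^'n \<Rightarrow> real^'n \<Rightarrow> real^'n^'n" where
  "outer u v = (\<chi> i j. u $ i * v $ j)"

lemma outer_mult_vec [simp]: "outer u v *v x = (v \<bullet> x) *\<^sub>R u"
  by (simp add: outer_def vec_eq_iff matrix_vector_mult_def inner_vec_def sum_distrib_left sum_distrib_right mult_ac)

lemma transpose_outer [simp]: "transpose (outer u v) = outer v u"
  by (simp add: outer_def transpose_def vec_eq_iff mult.commute)

lemma inner_outer: "outer u v \<bullet> C = u \<bullet> (C *v v)"
  by (simp add: outer_def inner_vec_def matrix_vector_mult_def sum_distrib_left mult_ac)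

lemma matrix_eqI: "(\<And>x. A *v x = B *v x) \<Longrightarrow> A = (B::real^'n^'m)"
  using matrix_eq by blast

lemma transpose_add: "transpose (A + B) = transpose A + transpose (B::real^'n^'m)"
  and transpose_diff: "transpose (A - B) = transpose A - transpose (B::real^'n^'m)"
  by (simp_all add: transpose_def vec_eq_iff)

lemmas mat_vec_simps = matrix_vector_mult_add_rdistrib matrix_vector_mult_diff_rdistrib
  matrix_vector_right_distrib matrix_vector_mult_diff_distrib matrix_vector_mult_scaleR scaleR_matrix_vector_assoc[symmetric]

lemma matrix_add_rdistrib: "(A + B) ** C = A ** C + B ** (C::real^'n^'m)"
  by (simp add: matrix_matrix_mult_def vec_eq_iff distrib_right sum.distrib)

lemma bounded_bilinear_matrix_mult:
  "bounded_bilinear ((**) :: real^'n^'m \<Rightarrow> real^'k^'n \<Rightarrow> real^'k^'m)"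
  unfolding bilinear_conv_bounded_bilinear[symmetric] bilinear_def
  by (auto intro!: linearI simp: matrix_add_rdistrib matrix_add_ldistrib scalar_matrix_assoc matrix_scalar_ac)

text \<open>The infinitesimal rotation from \<open>u\<close> towards \<open>w\<close>. For
  \<open>u = axis i 1\<close> and \<open>w = axis j 1\<close> its entry in row \<open>j\<close> and
  column \<open>i\<close> is 1, which fixes the signs used below.\<close>

definition plane_gen :: "real^'n \<Rightarrow> real^'n \<Rightarrow> real^'n^'n" where
  "plane_gen u w = outer w u - outer u w"

text \<open>For an orthonormal pair this is the exponential of \<open>\<alpha>\<close> times
  \<open>plane_gen u w\<close>. In closed form, smoothness in the angle and measurability in all
  arguments can be read off.\<close>

definition plane_rot :: "real^'n \<Rightarrow> real^'n \<Rightarrow> real \<Rightarrow> real^'n^'n" where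
  "plane_rot u w \<alpha> = mat 1 + (cos \<alpha> - 1) *\<^sub>R (outer u u + outer w w) + sin \<alpha> *\<^sub>R plane_gen u w"

definition orthonormal_pair :: "real^'n \<Rightarrow> real^'n \<Rightarrow> bool" where
  "orthonormal_pair u w \<longleftrightarrow> u \<bullet> u = 1 \<and> w \<bullet> w = 1 \<and> u \<bullet> w = 0"

lemma plane_gen_mult_vec: "plane_gen u w *v x = (u \<bullet> x) *\<^sub>R w - (w \<bullet> x) *\<^sub>R u"
  by (simp add: plane_gen_def mat_vec_simps)

lemma plane_rot_mult_vec:
  "plane_rot u w \<alpha> *v x = x + (cos \<alpha> - 1) *\<^sub>R ((u \<bullet> x) *\<^sub>R u + (w \<bullet> x) *\<^sub>R w)
     + sin \<alpha> *\<^sub>R ((u \<bullet> x) *\<^sub>R w - (w \<bullet> x) *\<^sub>R u)"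
  by (simp add: plane_rot_def mat_vec_simps plane_gen_mult_vec)

lemma plane_rot_0 [simp]: "plane_rot u w 0 = mat 1"
  by (simp add: plane_rot_def)

lemma transpose_plane_gen: "transpose (plane_gen u w) = - plane_gen u w"
  by (simp add: plane_gen_def transpose_diff)

lemma transpose_plane_rot: "transpose (plane_rot u w \<alpha>) = plane_rot u w (- \<alpha>)"
  by (simp add: plane_rot_def transpose_add transpose_scalar transpose_plane_gen)

text \<open>On the coordinates along \<open>u\<close> and \<open>w\<close> the map acts as the usual
  2 by 2 rotation, so the claim reduces to the addition theorems for sine and cosine.\<close>

lemma plane_rot_add:
  assumes "orthonormal_pair u w"
  shows "plane_rot u w (\<alpha> + \<beta>) = plane_rot u w \<alpha> ** plane_rot u w \<beta>"
proof (rule matrix_eqI)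
  fix x
  have u: "u \<bullet> (plane_rot u w \<beta> *v x) = cos \<beta> * (u \<bullet> x) - sin \<beta> * (w \<bullet> x)"
    using assms by (simp add: plane_rot_mult_vec orthonormal_pair_def inner_simps algebra_simps)
  have w: "w \<bullet> (plane_rot u w \<beta> *v x) = cos \<beta> * (w \<bullet> x) + sin \<beta> * (u \<bullet> x)"
    using assms by (simp add: plane_rot_mult_vec orthonormal_pair_def inner_simps inner_commute[of w u] algebra_simps)
  show "plane_rot u w (\<alpha> + \<beta>) *v x = (plane_rot u w \<alpha> ** plane_rot u w \<beta>) *v x"
    unfolding matrix_vector_mul_assoc[symmetric] plane_rot_mult_vec[of u w \<alpha>] u w
    unfolding plane_rot_mult_vec by (simp add: cos_add sin_add algebra_simps)
qed

lemma plane_gen_commute: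
  assumes "orthonormal_pair u w"
  shows "plane_gen u w ** plane_rot u w \<alpha> = plane_rot u w \<alpha> ** plane_gen u w"
  using assms unfolding orthonormal_pair_def
  by (intro matrix_eqI) (simp add: matrix_vector_mul_assoc[symmetric] plane_gen_mult_vec
      plane_rot_mult_vec inner_simps inner_commute[of w u] algebra_simps)

section \<open>The group SO(n)\<close>

lemma SO_mult: "a \<in> SO \<Longrightarrow> b \<in> SO \<Longrightarrow> a ** b \<in> SO"
proof -
  assume a: "a \<in> SO" "b \<in> SO"
  have "(a ** b) ** transpose (a ** b) = a ** (b ** transpose b) ** transpose a"
    by (simp add: matrix_transpose_mul matrix_mul_assoc)
  with a show ?thesis by (simp add: SO_def det_mul)
qed

lemma SO_transpose: "a \<in> SO \<Longrightarrow> transpose a \<in> SO"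
  by (simp add: SO_def matrix_left_right_inverse det_transpose)

lemma SO_mult_transpose: "a \<in> SO \<Longrightarrow> a ** transpose a = mat 1" "a \<in> SO \<Longrightarrow> transpose a ** a = mat 1"
  by (simp_all add: SO_def matrix_left_right_inverse)

lemma mat_1_SO [simp]: "mat 1 \<in> SO"
  by (simp add: SO_def)

text \<open>A rotation is the square of the rotation by half the angle. The latter is orthogonal, so
  its determinant squares to 1.\<close>

lemma plane_rot_SO:
  assumes "orthonormal_pair u w"
  shows "plane_rot u w \<alpha> \<in> SO"
proof -
  have orth: "plane_rot u w \<beta> ** transpose (plane_rot u w \<beta>) = mat 1" for \<beta>
    using plane_rot_add[OF assms, of \<beta> "-\<beta>"] by (simp add: transpose_plane_rot)
  have "det (plane_rot u w (\<alpha>/2)) * det (plane_rot u w (\<alpha>/2)) = 1"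
    using arg_cong[OF orth[of "\<alpha>/2"], of det] by (simp add: det_mul det_transpose)
  then have "det (plane_rot u w \<alpha>) = 1"
    using arg_cong[OF plane_rot_add[OF assms, of "\<alpha>/2" "\<alpha>/2"], of det] by (simp add: det_mul)
  with orth show ?thesis by (simp add: SO_def)
qed

lemma orthonormal_pair_axis: "i \<noteq> j \<Longrightarrow> orthonormal_pair (axis i 1) (axis j 1)"
  by (auto simp: orthonormal_pair_def inner_axis_axis)

lemma rot_eq_plane_rot:
  fixes i j :: "'n::finite"
  assumes "i \<noteq> j"
  shows "rot i j \<theta> = plane_rot (axis i 1) (axis j 1) \<theta>"
proof -
  have "rot i j \<theta> $ r $ c = plane_rot (axis i 1) (axis j 1) \<theta> $ r $ c" for r c
    using assms by (auto simp: rot_def plane_rot_def plane_gen_def outer_def axis_def mat_def)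
  then show ?thesis by (simp add: vec_eq_iff)
qed

section \<open>Invariance of the Hilbert-Schmidt inner product\<close>

lemma inner_mult_left_SO:
  fixes R A B :: "real^'n^'n"
  assumes "R \<in> SO"
  shows "(R ** A) \<bullet> (R ** B) = A \<bullet> B"
  using assms
  by (simp add: hs_inner_eq_inner[symmetric] hs_inner_def matrix_transpose_mul matrix_mul_assoc)
     (simp add: matrix_mul_assoc[symmetric] SO_mult_transpose)

lemma inner_transpose: "transpose A \<bullet> transpose B = A \<bullet> (B::real^'n^'m)"
  by (simp add: inner_vec_def transpose_def) (rule sum.swap)

lemma inner_mult_right_SO:
  fixes R A B :: "real^'n^'n"
  assumes "R \<in> SO"
  shows "(A ** R) \<bullet> (B ** R) = A \<bullet> B"
  using inner_mult_left_SO[OF SO_transpose[OF assms], of "transpose A" "transpose B"]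
  by (simp add: matrix_transpose_mul[symmetric] inner_transpose)

lemma norm_mult_SO:
  fixes R A :: "real^'n^'n"
  assumes "R \<in> SO"
  shows "norm (R ** A) = norm A" "norm (A ** R) = norm A"
  using assms by (simp_all add: norm_eq_sqrt_inner inner_mult_left_SO inner_mult_right_SO)

text \<open>The two outer products in \<open>plane_gen\<close> contribute equally when
  \<open>C\<close> is skew. For basis vectors the pairing reads off twice one matrix entry.\<close>

lemma inner_plane_gen_skew:
  assumes "transpose C = - C"
  shows "plane_gen u w \<bullet> C = 2 * (w \<bullet> (C *v u))"
proof -
  have "u \<bullet> (C *v w) = (transpose C *v u) \<bullet> w"
    by (simp add: dot_lmul_matrix)
  also have "\<dots> = - (w \<bullet> (C *v u))"
    using assms by (simp add: inner_commute mat_vec_simps)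
       (metis (no_types, opaque_lifting) diff_zero inner_minus_right matrix_vector_mult_0 mat_vec_simps(2) minus_diff_eq inner_commute add.inverse_inverse diff_0)
  finally show ?thesis by (simp add: plane_gen_def inner_diff_left inner_outer)
qed

lemma inner_plane_gen_self:
  assumes "orthonormal_pair u w"
  shows "plane_gen u w \<bullet> plane_gen u w = 2"
  using assms inner_plane_gen_skew[OF transpose_plane_gen, of u w u w]
  by (simp add: plane_gen_mult_vec orthonormal_pair_def inner_simps inner_commute)

text \<open>The rotation commutes with its own generator, so conjugating back leaves the norm of
  \<open>a *\<^sub>R plane_gen u w + C\<close>. Writing c for the entry
  \<open>w \<bullet> (C *v u)\<close>, two cases matter: c = 0 makes the summands orthogonal, and
  the minimiser a = -c lowers the squared norm by twice the square of c.\<close>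

lemma norm_plane_gen_add_conj:
  fixes C :: "real^'n^'n"
  assumes on: "orthonormal_pair u w" and C: "transpose C = - C" and R: "R = plane_rot u w \<alpha>"
  shows "(norm (a *\<^sub>R plane_gen u w + R ** C ** transpose R))\<^sup>2
    = 2 * a\<^sup>2 + 4 * a * (w \<bullet> (C *v u)) + (norm C)\<^sup>2"
proof -
  have RS: "R \<in> SO" using plane_rot_SO[OF on] R by simp
  let ?J = "plane_gen u w"
  interpret bilin: bounded_bilinear "(**) :: real^'n^'n \<Rightarrow> _ \<Rightarrow> _"
    by (rule bounded_bilinear_matrix_mult)
  have "R ** ?J ** transpose R = ?J ** (R ** transpose R)"
    by (simp add: R plane_gen_commute[OF on, symmetric] matrix_mul_assoc)
  then have "R ** ?J ** transpose R = ?J" using RS by (simp add: SO_mult_transpose)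
  then have "a *\<^sub>R ?J + R ** C ** transpose R = R ** (a *\<^sub>R ?J + C) ** transpose R"
    by (simp add: bilin.add_left bilin.add_right bilin.scaleR_left bilin.scaleR_right)
  then have "norm (a *\<^sub>R ?J + R ** C ** transpose R) = norm (a *\<^sub>R ?J + C)"
    using RS by (simp add: norm_mult_SO SO_transpose)
  also have "(norm (a *\<^sub>R ?J + C))\<^sup>2 = a\<^sup>2 * (?J \<bullet> ?J) + 2 * a * (?J \<bullet> C) + C \<bullet> C"
    unfolding power2_norm_eq_inner by (simp add: inner_simps inner_commute power2_eq_square algebra_simps)
  finally show ?thesis
    by (simp add: inner_plane_gen_self[OF on] inner_plane_gen_skew[OF C] power2_norm_eq_inner)
qed

subsection \<open>Smooth curves in the rotation group\<close>

text \<open>Derivatives at 0 and 1 are one-sided, in agreement with \<open>smooth_on_Icc\<close>.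
  The recursion on the order lets closure properties be proved by induction.\<close>

primrec C_k :: "nat \<Rightarrow> (real \<Rightarrow> 'a::real_normed_vector) \<Rightarrow> bool" where
  "C_k 0 f \<longleftrightarrow> continuous_on {0..1} f"
| "C_k (Suc k) f \<longleftrightarrow> (\<exists>f'. (\<forall>t\<in>{0..1}. (f has_vector_derivative f' t) (at t within {0..1})) \<and> C_k k f')"

definition smooth :: "(real \<Rightarrow> 'a::real_normed_vector) \<Rightarrow> bool" where
  "smooth f \<longleftrightarrow> (\<forall>k. C_k k f)"

lemma C_k_continuous_on: "C_k k f \<Longrightarrow> continuous_on {0..1} f"
  by (cases k) (auto simp: continuous_on_eq_continuous_within intro: has_vector_derivative_continuous)

lemma smooth_continuous_on: "smooth f \<Longrightarrow> continuous_on {0..1} f"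
  unfolding smooth_def using C_k_continuous_on by blast

lemma C_k_cong:
  assumes "C_k k f" and eq: "\<And>t. t \<in> {0..1} \<Longrightarrow> f t = g t"
  shows "C_k k g"
proof (cases k)
  case 0
  then show ?thesis
    using assms(1) continuous_on_eq[of "{0..1}" f g, OF _ eq] by simp
next
  case (Suc m)
  with assms(1) obtain f' where f': "\<forall>t\<in>{0..1}. (f has_vector_derivative f' t) (at t within {0..1})" "C_k m f'"
    by auto
  have "(g has_vector_derivative f' t) (at t within {0..1})" if t: "t \<in> {0..1}" for t
    by (rule has_vector_derivative_transform[OF t eq[symmetric] f'(1)[rule_format, OF t]])
  with f'(2) show ?thesis
    unfolding Suc C_k.simps by blast
qed

lemma C_k_Suc_imp: "C_k (Suc k) f \<Longrightarrow> C_k k f"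
proof (induction k arbitrary: f)
  case 0
  then show ?case using C_k_continuous_on[of "Suc 0" f] by simp
next
  case (Suc k)
  from Suc.prems obtain f' where
    "\<forall>t\<in>{0..1}. (f has_vector_derivative f' t) (at t within {0..1})" "C_k (Suc k) f'"
    unfolding C_k.simps(2)[of "Suc k"] by blast
  with Suc.IH[of f'] show ?case
    unfolding C_k.simps(2)[of k f] by blast
qed

lemma C_k_SucI:
  assumes "\<And>t. t \<in> {0..1} \<Longrightarrow> (f has_vector_derivative f' t) (at t within {0..1})" and "C_k k f'"
  shows "C_k (Suc k) f"
  unfolding C_k.simps using assms by (intro exI[of _ f'] conjI ballI)

lemma C_k_SucE:
  assumes "C_k (Suc k) f"
  obtains f' where "\<And>t. t \<in> {0..1} \<Longrightarrow> (f has_vector_derivative f' t) (at t within {0..1})" and "C_k k f'"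
proof -
  from assms obtain f' where "\<forall>t\<in>{0..1}. (f has_vector_derivative f' t) (at t within {0..1})" "C_k k f'"
    unfolding C_k.simps by blast
  then show thesis by (intro that[of f']) auto
qed

lemma C_k_add: "C_k k f \<Longrightarrow> C_k k g \<Longrightarrow> C_k k (\<lambda>t. f t + g t)"
proof (induction k arbitrary: f g)
  case 0
  then show ?case by (auto intro: continuous_on_add)
next
  case (Suc k)
  from Suc.prems(1) obtain f' where f': "\<And>t. t \<in> {0..1} \<Longrightarrow> (f has_vector_derivative f' t) (at t within {0..1})" "C_k k f'"
    by (rule C_k_SucE) (rule that)
  from Suc.prems(2) obtain g' where g': "\<And>t. t \<in> {0..1} \<Longrightarrow> (g has_vector_derivative g' t) (at t within {0..1})" "C_k k g'"
    by (rule C_k_SucE) (rule that)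
  show ?case
    by (rule C_k_SucI[OF has_vector_derivative_add[OF f'(1) g'(1)] Suc.IH[OF f'(2) g'(2)]])
qed

lemma C_k_const: "C_k k (\<lambda>t. c)"
proof (induction k arbitrary: c)
  case (Suc k)
  show ?case by (rule C_k_SucI[OF has_vector_derivative_const Suc.IH])
qed simp

lemma C_k_bilinear:
  assumes "bounded_bilinear pr"
  shows "C_k k f \<Longrightarrow> C_k k g \<Longrightarrow> C_k k (\<lambda>t. pr (f t) (g t))"
proof (induction k arbitrary: f g)
  case 0
  then show ?case by (auto intro: bounded_bilinear.continuous_on[OF assms])
next
  case (Suc k)
  from Suc.prems(1) obtain f' where f': "\<And>t. t \<in> {0..1} \<Longrightarrow> (f has_vector_derivative f' t) (at t within {0..1})" "C_k k f'"
    by (rule C_k_SucE) (rule that)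
  from Suc.prems(2) obtain g' where g': "\<And>t. t \<in> {0..1} \<Longrightarrow> (g has_vector_derivative g' t) (at t within {0..1})" "C_k k g'"
    by (rule C_k_SucE) (rule that)
  show ?case
    by (rule C_k_SucI[OF bounded_bilinear.has_vector_derivative[OF assms f'(1) g'(1)]
      C_k_add[OF Suc.IH[OF C_k_Suc_imp[OF Suc.prems(1)] g'(2)] Suc.IH[OF f'(2) C_k_Suc_imp[OF Suc.prems(2)]]]])
qed

lemma smooth_const: "smooth (\<lambda>t. c)"
  by (simp add: smooth_def C_k_const)

lemma smooth_add: "smooth f \<Longrightarrow> smooth g \<Longrightarrow> smooth (\<lambda>t. f t + g t)"
  by (simp add: smooth_def C_k_add)

lemma smooth_bilinear: "bounded_bilinear pr \<Longrightarrow> smooth f \<Longrightarrow> smooth g \<Longrightarrow> smooth (\<lambda>t. pr (f t) (g t))"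
  by (simp add: smooth_def C_k_bilinear)

lemma smooth_linear: "bounded_linear h \<Longrightarrow> smooth f \<Longrightarrow> smooth (\<lambda>t. h (f t))"
  \<comment> \<open>A linear map \<open>h\<close> is the bilinear map sending c and x to c times
    h(x), taken at c = 1.\<close>
  using smooth_bilinear[OF bounded_bilinear.comp[OF bounded_bilinear_scaleR bounded_linear_ident], of h "\<lambda>t. 1" f]
  by (simp add: smooth_const)

text \<open>Bootstrapping for differential equations: if the derivative is as regular as the
  function itself, the order of differentiability rises without end.\<close>

lemma smoothI_deriv:
  assumes d: "\<And>t. t \<in> {0..1} \<Longrightarrow> (f has_vector_derivative f' t) (at t within {0..1})"
    and "\<And>k. C_k k f \<Longrightarrow> C_k k f'"
  shows "smooth f"
proof -
  have "C_k k f" for k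
  proof (induction k)
    case 0
    show ?case
      unfolding C_k.simps continuous_on_eq_continuous_within
      using d has_vector_derivative_continuous by blast
  next
    case (Suc k)
    show ?case by (rule C_k_SucI[OF d assms(2)[OF Suc.IH]])
  qed
  then show ?thesis by (simp add: smooth_def)
qed

text \<open>Each \<open>C_k\<close> supplies its own chain of derivatives, whereas one infinite
  chain is required. Derivatives on the interval are unique, so iterating
  \<open>vector_derivative\<close> produces it.\<close>

lemma smooth_smooth_on_Icc:
  fixes f :: "real \<Rightarrow> 'a::real_normed_vector"
  assumes "smooth f"
  shows "smooth_on_Icc f 0 1"
proof -
  let ?D = "\<lambda>f t. vector_derivative f (at t within {0..1::real})"
  have D: "(h has_vector_derivative ?D h t) (at t within {0..1})" "smooth (?D h)"
    if "smooth h" "t \<in> {0..1}" for h :: "real \<Rightarrow> 'a" and t :: real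
  proof -
    have *: "\<exists>h'. (\<forall>t\<in>{0..1}. (h has_vector_derivative h' t) (at t within {0..1})) \<and> C_k k h'" for k
      using that(1) C_k.simps(2)[of k h] by (simp add: smooth_def del: C_k.simps)
    have eq: "?D h t = h' t" if "\<forall>t\<in>{0..1}. (h has_vector_derivative h' t) (at t within {0..1})" "t \<in> {0..1}" for h' t
      using that by (intro vector_derivative_within_cbox[where a=0 and b=1, simplified]) auto
    show "(h has_vector_derivative ?D h t) (at t within {0..1})"
      using *[of 0] that(2) eq by metis
    show "smooth (?D h)"
      unfolding smooth_def
    proof
      fix k
      from *[of k] obtain h' where h': "\<forall>t\<in>{0..1}. (h has_vector_derivative h' t) (at t within {0..1})" "C_k k h'"
        by blast
      then show "C_k k (?D h)" using eq by (intro C_k_cong[OF h'(2)]) simp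
    qed
  qed
  define g where "g k = (?D ^^ k) f" for k
  have sm: "smooth (g k)" for k
    by (induction k) (auto simp: g_def assms intro!: D(2)[of _ 0])
  then show ?thesis
    unfolding smooth_on_Icc_def using D(1)[OF sm]
    by (intro exI[of _ g]) (auto simp: g_def)
qed

section \<open>Curves in SO(n), their energy and the Riemannian distance\<close>

text \<open>The velocity is translated back to the identity from the right. So \<open>B\<close> is
  skew, its norm is the speed of the curve, and it does not change when the curve is multiplied from
  the right by a fixed rotation.\<close>

definition SO_curve :: "(real \<Rightarrow> real^'n^'n) \<Rightarrow> (real \<Rightarrow> real^'n^'n) \<Rightarrow> bool" where
  "SO_curve \<gamma> B \<longleftrightarrow> smooth B \<and> (\<forall>t\<in>{0..1}. \<gamma> t \<in> SO \<and> transpose (B t) = - B t \<and>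
     (\<gamma> has_vector_derivative B t ** \<gamma> t) (at t within {0..1}))"

text \<open>The equation \<open>\<gamma>' = B \<gamma>\<close> with smooth \<open>B\<close> passes
  the regularity of \<open>\<gamma>\<close> on to its derivative.\<close>

lemma SO_curve_smooth:
  assumes "SO_curve \<gamma> B"
  shows "smooth \<gamma>"
proof (rule smoothI_deriv[where f' = "\<lambda>t. B t ** \<gamma> t"])
  show "C_k k \<gamma> \<Longrightarrow> C_k k (\<lambda>t. B t ** \<gamma> t)" for k
    using assms by (intro C_k_bilinear[OF bounded_bilinear_matrix_mult]) (auto simp: SO_curve_def smooth_def)
qed (use assms in \<open>auto simp: SO_curve_def\<close>)

definition energy :: "(real \<Rightarrow> real^'n^'n) \<Rightarrow> real" where
  "energy B = integral {0..1} (\<lambda>t. (norm (B t))\<^sup>2)"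

lemma energy_nonneg: "0 \<le> energy B"
  unfolding energy_def by (cases "(\<lambda>t. (norm (B t))\<^sup>2) integrable_on {0..1}")
    (auto intro: integral_nonneg simp: not_integrable_integral)

lemma hs_length_nonneg: "0 \<le> hs_length \<gamma>"
  unfolding hs_length_def Let_def
  by (cases "(\<lambda>t. sqrt (hs_inner (vector_derivative \<gamma> (at t within {0..1})) (vector_derivative \<gamma> (at t within {0..1})))) integrable_on {0..1}")
    (auto intro: integral_nonneg simp: not_integrable_integral hs_inner_eq_inner)

text \<open>Cauchy-Schwarz on an interval of length 1: energy minus squared length is the integral
  of the squared deviation of the speed from its mean.\<close>

lemma hs_length_le_energy:
  assumes "SO_curve \<gamma> B"
  shows "(hs_length \<gamma>)\<^sup>2 \<le> energy B"
proof -
  have c: "continuous_on {0..1} B"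
    using assms by (auto simp: SO_curve_def intro: smooth_continuous_on)
  have "sqrt (hs_inner (vector_derivative \<gamma> (at t within {0..1})) (vector_derivative \<gamma> (at t within {0..1}))) = norm (B t)"
    if t: "t \<in> {0..1}" for t
  proof -
    have "vector_derivative \<gamma> (at t within {0..1}) = B t ** \<gamma> t"
      using assms t by (intro vector_derivative_within_cbox[where a=0 and b=1, simplified]) (auto simp: SO_curve_def)
    then show ?thesis
      using assms t by (simp add: hs_inner_eq_inner norm_eq_sqrt_inner[symmetric] norm_mult_SO SO_curve_def)
  qed
  then have L: "hs_length \<gamma> = integral {0..1} (\<lambda>t. norm (B t))"
    unfolding hs_length_def Let_def by (intro integral_cong) auto
  define l where "l = hs_length \<gamma>"
  have i1: "(\<lambda>t. norm (B t)) integrable_on {0..1}"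
    by (intro integrable_continuous_real continuous_intros c)
  have i2: "(\<lambda>t. (norm (B t))\<^sup>2) integrable_on {0..1}"
    by (intro integrable_continuous_real continuous_intros c)
  have "0 \<le> integral {0..1} (\<lambda>t. (norm (B t) - l)\<^sup>2)"
    by (intro integral_nonneg integrable_continuous_real continuous_intros c) auto
  also have "(\<lambda>t. (norm (B t) - l)\<^sup>2) = (\<lambda>t. (norm (B t))\<^sup>2 - 2 * l * norm (B t) + l\<^sup>2)"
    by (auto simp: power2_diff algebra_simps)
  also have "integral {0..1} \<dots> = energy B - 2 * l * l + l\<^sup>2"
  proof (rule integral_unique)
    show "((\<lambda>t. (norm (B t))\<^sup>2 - 2 * l * norm (B t) + l\<^sup>2) has_integral energy B - 2 * l * l + l\<^sup>2) {0..1}"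
    proof -
      have "((\<lambda>t. norm (B t)) has_integral l) {0..1}"
        using i1 L by (simp add: l_def integrable_integral)
      moreover have "((\<lambda>t. (norm (B t))\<^sup>2) has_integral energy B) {0..1}"
        using i2 by (simp add: energy_def integrable_integral)
      moreover have "((\<lambda>t::real. l\<^sup>2) has_integral l\<^sup>2) {0..1}"
        using has_integral_const_real[of "l\<^sup>2" 0 1] by simp
      ultimately show ?thesis
        by (intro has_integral_add has_integral_diff has_integral_mult_right)
    qed
  qed
  finally show ?thesis by (simp add: l_def power2_eq_square)
qed

lemma riem_dist_bounds:
  assumes "SO_curve \<gamma> B" "\<gamma> 0 = a" "\<gamma> 1 = b"
  shows "0 \<le> riem_dist a b" and "riem_dist a b \<le> hs_length \<gamma>"
proof -
  have "piecewise_smooth \<gamma>"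
    unfolding piecewise_smooth_def
    using smooth_smooth_on_Icc[OF SO_curve_smooth[OF assms(1)]]
    \<comment> \<open>A single smooth piece, with break points 0 and 1.\<close>
    by (intro exI[of _ 1] exI[of _ "\<lambda>k. real k"]) auto
  then have mem: "hs_length \<gamma> \<in> {hs_length \<gamma> | \<gamma>.
     piecewise_smooth \<gamma> \<and> \<gamma> ` {0..1} \<subseteq> SO \<and> \<gamma> 0 = a \<and> \<gamma> 1 = b}"
    using assms by (auto simp: SO_curve_def)
  then show "0 \<le> riem_dist a b"
    unfolding riem_dist_def by (intro cInf_greatest) (auto simp: hs_length_nonneg)
  show "riem_dist a b \<le> hs_length \<gamma>"
    unfolding riem_dist_def by (intro cInf_lower mem bdd_belowI[of _ 0]) (auto simp: hs_length_nonneg)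
qed

lemma riem_dist_le_energy:
  assumes "SO_curve \<gamma> B"
  shows "(riem_dist (\<gamma> 0) (\<gamma> 1))\<^sup>2 \<le> energy B"
  using power_mono[OF riem_dist_bounds(2,1)[OF assms refl refl], of 2] hs_length_le_energy[OF assms]
  by simp

lemma SO_curve_const: "a \<in> SO \<Longrightarrow> SO_curve (\<lambda>t. a) (\<lambda>t. 0)"
  by (auto simp: SO_curve_def smooth_const transpose_def vec_eq_iff)

lemma bounded_linear_transpose: "bounded_linear (transpose :: real^'n^'m \<Rightarrow> real^'m^'n)"
  unfolding linear_conv_bounded_linear[symmetric]
  by (intro linearI) (simp_all add: transpose_add transpose_scalar)

lemma smooth_matrix_mult: "smooth f \<Longrightarrow> smooth g \<Longrightarrow> smooth (\<lambda>t. f t ** (g t :: real^'n^'m))"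
  by (rule smooth_bilinear[OF bounded_bilinear_matrix_mult])

text \<open>By the product rule the velocities add once that of the second factor is conjugated by
  the first factor.\<close>

lemma SO_curve_mult:
  fixes \<gamma> \<gamma>' :: "real \<Rightarrow> real^'n^'n"
  assumes "SO_curve \<gamma> B" "SO_curve \<gamma>' B'"
  shows "SO_curve (\<lambda>t. \<gamma> t ** \<gamma>' t) (\<lambda>t. B t + \<gamma> t ** B' t ** transpose (\<gamma> t))"
  unfolding SO_curve_def
proof (intro conjI ballI)
  note bilin_minus = bounded_bilinear.minus_left[OF bounded_bilinear_matrix_mult]
    bounded_bilinear.minus_right[OF bounded_bilinear_matrix_mult]
  have sm: "smooth B" "smooth B'" "smooth \<gamma>"
    using assms SO_curve_smooth[OF assms(1)] by (simp_all add: SO_curve_def)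
  show "smooth (\<lambda>t. B t + \<gamma> t ** B' t ** transpose (\<gamma> t))"
    by (rule smooth_add[OF sm(1) smooth_matrix_mult[OF smooth_matrix_mult[OF sm(3,2)]
          smooth_linear[OF bounded_linear_transpose sm(3)]]])
  fix t :: real
  assume t: "t \<in> {0..1}"
  with assms show "\<gamma> t ** \<gamma>' t \<in> SO" by (auto simp: SO_curve_def SO_mult)
  have B: "transpose (B t) = - B t" "transpose (B' t) = - B' t" "\<gamma> t \<in> SO"
    using assms t by (auto simp: SO_curve_def)
  then show "transpose (B t + \<gamma> t ** B' t ** transpose (\<gamma> t)) = - (B t + \<gamma> t ** B' t ** transpose (\<gamma> t))"
    by (simp add: transpose_add matrix_transpose_mul matrix_mul_assoc bilin_minus)
  have "((\<lambda>t. \<gamma> t ** \<gamma>' t) has_vector_derivative \<gamma> t ** (B' t ** \<gamma>' t) + (B t ** \<gamma> t) ** \<gamma>' t) (at t within {0..1})"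
    using assms t by (intro bounded_bilinear.has_vector_derivative[OF bounded_bilinear_matrix_mult]) (auto simp: SO_curve_def)
  also have "\<gamma> t ** (B' t ** \<gamma>' t) + (B t ** \<gamma> t) ** \<gamma>' t
      = (B t + \<gamma> t ** B' t ** transpose (\<gamma> t)) ** (\<gamma> t ** \<gamma>' t)"
  proof -
    have "(\<gamma> t ** B' t ** transpose (\<gamma> t)) ** (\<gamma> t ** \<gamma>' t) = \<gamma> t ** B' t ** (transpose (\<gamma> t) ** \<gamma> t) ** \<gamma>' t"
      by (simp add: matrix_mul_assoc)
    also have "\<dots> = \<gamma> t ** B' t ** \<gamma>' t"
      using B(3) by (simp add: SO_mult_transpose)
    finally show ?thesis
      by (simp add: matrix_add_rdistrib matrix_mul_assoc add.commute)
  qed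
  finally show "((\<lambda>t. \<gamma> t ** \<gamma>' t) has_vector_derivative
      (B t + \<gamma> t ** B' t ** transpose (\<gamma> t)) ** (\<gamma> t ** \<gamma>' t)) (at t within {0..1})" .
qed

text \<open>Rotations in one plane commute, so the velocity is the angular speed times the fixed
  generator, even if the speed varies.\<close>

lemma SO_curve_plane_rot:
  fixes \<alpha> \<alpha>' :: "real \<Rightarrow> real"
  assumes on: "orthonormal_pair u w" and s: "smooth \<alpha>'"
    and d: "\<And>t. t \<in> {0..1} \<Longrightarrow> (\<alpha> has_vector_derivative \<alpha>' t) (at t within {0..1})"
  shows "SO_curve (\<lambda>t. plane_rot u w (\<alpha> t)) (\<lambda>t. \<alpha>' t *\<^sub>R plane_gen u w)"
  unfolding SO_curve_def
proof (intro conjI ballI)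
  show "smooth (\<lambda>t. \<alpha>' t *\<^sub>R plane_gen u w)"
    by (intro smooth_bilinear[OF bounded_bilinear_scaleR] s smooth_const)
  fix t :: real
  assume t: "t \<in> {0..1}"
  show "plane_rot u w (\<alpha> t) \<in> SO" by (rule plane_rot_SO[OF on])
  show "transpose (\<alpha>' t *\<^sub>R plane_gen u w) = - (\<alpha>' t *\<^sub>R plane_gen u w)"
    by (simp add: transpose_scalar transpose_plane_gen)
  have J: "(\<alpha>' t *\<^sub>R plane_gen u w) ** plane_rot u w (\<alpha> t) =
      (- sin (\<alpha> t) * \<alpha>' t) *\<^sub>R (outer u u + outer w w) + (cos (\<alpha> t) * \<alpha>' t) *\<^sub>R plane_gen u w"
    using on unfolding orthonormal_pair_def
    by (intro matrix_eqI) (simp add: matrix_vector_mul_assoc[symmetric] mat_vec_simps plane_gen_mult_vec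
      plane_rot_mult_vec inner_simps inner_commute[of w u] algebra_simps)
  have "((\<lambda>t. cos (\<alpha> t) - 1) has_vector_derivative - sin (\<alpha> t) * \<alpha>' t) (at t within {0..1})"
    "((\<lambda>t. sin (\<alpha> t)) has_vector_derivative cos (\<alpha> t) * \<alpha>' t) (at t within {0..1})"
    using d[OF t] unfolding has_real_derivative_iff_has_vector_derivative[symmetric]
    by (auto intro!: derivative_eq_intros)
  then have "((\<lambda>t. mat 1 + (cos (\<alpha> t) - 1) *\<^sub>R (outer u u + outer w w) + sin (\<alpha> t) *\<^sub>R plane_gen u w)
      has_vector_derivative 0 + (- sin (\<alpha> t) * \<alpha>' t) *\<^sub>R (outer u u + outer w w)
        + (cos (\<alpha> t) * \<alpha>' t) *\<^sub>R plane_gen u w) (at t within {0..1})"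
    by (intro has_vector_derivative_add[OF has_vector_derivative_add[OF has_vector_derivative_const]]
        bounded_linear.has_vector_derivative[OF bounded_linear_scaleR_left])
  then show "((\<lambda>t. plane_rot u w (\<alpha> t)) has_vector_derivative
      (\<alpha>' t *\<^sub>R plane_gen u w) ** plane_rot u w (\<alpha> t)) (at t within {0..1})"
    unfolding J by (simp only: plane_rot_def add_0)
qed

subsection \<open>A curve from the identity to a given rotation\<close>

lemma borel_measurable_matrix_mult [measurable (raw)]:
  fixes f :: "'a \<Rightarrow> real^'n^'m" and g :: "'a \<Rightarrow> real^'k^'n"
  assumes "f \<in> borel_measurable M" "g \<in> borel_measurable M"
  shows "(\<lambda>x. f x ** g x) \<in> borel_measurable M"
  using assms
  by (rule borel_measurable_continuous_Pair)
    (intro bounded_bilinear.continuous_on[OF bounded_bilinear_matrix_mult] continuous_intros)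

lemma borel_measurable_bounded_linear:
  fixes f :: "'a \<Rightarrow> 'b::euclidean_space" and h :: "'b \<Rightarrow> 'c::euclidean_space"
  assumes "bounded_linear h" "f \<in> borel_measurable M"
  shows "(\<lambda>x. h (f x)) \<in> borel_measurable M"
  using borel_measurable_continuous_on[OF linear_continuous_on[OF assms(1)] assms(2)] .

lemmas borel_measurable_transpose [measurable (raw)] =
  borel_measurable_bounded_linear[OF bounded_linear_transpose]

lemma borel_measurable_mult_axis [measurable (raw)]:
  "f \<in> borel_measurable M \<Longrightarrow> (\<lambda>x. (f x :: real^'n^'m) *v v) \<in> borel_measurable M"
  by (rule borel_measurable_bounded_linear[of "\<lambda>A. A *v v"])
    (auto simp: linear_conv_bounded_linear[symmetric] mat_vec_simps intro!: linearI)

lemma borel_measurable_vec_nth_real [measurable (raw)]: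
  "f \<in> borel_measurable M \<Longrightarrow> (\<lambda>x. (f x :: real^'n) $ k) \<in> borel_measurable M"
  by (rule borel_measurable_bounded_linear[OF bounded_linear_vec_nth])

lemma borel_measurable_mat_nth [measurable (raw)]:
  "f \<in> borel_measurable M \<Longrightarrow> (\<lambda>x. (f x :: real^'n^'m) $ k) \<in> borel_measurable M"
  by (rule borel_measurable_bounded_linear[OF bounded_linear_vec_nth])

lemma bounded_bilinear_outer: "bounded_bilinear (outer :: real^'n \<Rightarrow> real^'n \<Rightarrow> real^'n^'n)"
  unfolding bilinear_conv_bounded_bilinear[symmetric] bilinear_def
  by (auto intro!: linearI simp: outer_def vec_eq_iff algebra_simps)

lemma borel_measurable_outer [measurable (raw)]:
  fixes f g :: "'a \<Rightarrow> real^'n"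
  assumes "f \<in> borel_measurable M" "g \<in> borel_measurable M"
  shows "(\<lambda>x. outer (f x) (g x)) \<in> borel_measurable M"
  using assms
  by (rule borel_measurable_continuous_Pair)
    (intro bounded_bilinear.continuous_on[OF bounded_bilinear_outer] continuous_intros)

lemma borel_measurable_plane_gen [measurable (raw)]:
  fixes f g :: "'a \<Rightarrow> real^'n"
  assumes [measurable]: "f \<in> borel_measurable M" "g \<in> borel_measurable M"
  shows "(\<lambda>x. plane_gen (f x) (g x)) \<in> borel_measurable M"
  unfolding plane_gen_def by measurable

lemma borel_measurable_plane_rot [measurable (raw)]:
  fixes f g :: "'a \<Rightarrow> real^'n"
  assumes [measurable]: "f \<in> borel_measurable M" "g \<in> borel_measurable M" "a \<in> borel_measurable M"
  shows "(\<lambda>x. plane_rot (f x) (g x) (a x)) \<in> borel_measurable M"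
  unfolding plane_rot_def by measurable

section \<open>Bringing one column of a rotation to its place\<close>

definition col_rest :: "'n \<Rightarrow> real^'n^'n \<Rightarrow> real^'n" where
  "col_rest k v = v *v axis k 1 - (v $ k $ k) *\<^sub>R axis k 1"

text \<open>Together with \<open>axis k 1\<close> this spans the plane in which
  \<open>axis k 1\<close> is turned onto the k-th column. If that column is plus or minus
  \<open>axis k 1\<close>, the plane is not determined and \<open>axis l 1\<close> serves as a
  default direction.\<close>

definition col_dir :: "'n \<Rightarrow> 'n \<Rightarrow> real^'n^'n \<Rightarrow> real^'n" where
  "col_dir k l v = (if col_rest k v = 0 then axis l 1 else (1 / norm (col_rest k v)) *\<^sub>R col_rest k v)"

text \<open>Clipping makes this a continuous function on all matrices; diagonal entries of rotations
  lie in [-1, 1] and are unaffected.\<close>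

definition col_angle :: "'n \<Rightarrow> real^'n^'n \<Rightarrow> real" where
  "col_angle k v = arccos (max (- 1) (min 1 (v $ k $ k)))"

definition col_rot :: "'n \<Rightarrow> 'n \<Rightarrow> real^'n^'n \<Rightarrow> real \<Rightarrow> real^'n^'n" where
  "col_rot k l v s = plane_rot (axis k 1) (col_dir k l v) (s * col_angle k v)"

definition col_reduce :: "'n \<Rightarrow> 'n \<Rightarrow> real^'n^'n \<Rightarrow> real^'n^'n" where
  "col_reduce k l v = transpose (col_rot k l v 1) ** v"

lemma borel_measurable_col_rest [measurable (raw)]:
  assumes [measurable]: "f \<in> borel_measurable M"
  shows "(\<lambda>x. col_rest k (f x)) \<in> borel_measurable M"
  unfolding col_rest_def by measurable

lemma borel_measurable_col_dir [measurable (raw)]: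
  assumes [measurable]: "f \<in> borel_measurable M"
  shows "(\<lambda>x. col_dir k l (f x)) \<in> borel_measurable M"
  unfolding col_dir_def by measurable

lemma borel_measurable_col_angle [measurable (raw)]:
  assumes [measurable]: "f \<in> borel_measurable M"
  shows "(\<lambda>x. col_angle k (f x)) \<in> borel_measurable M"
proof -
  have "continuous_on UNIV (\<lambda>t::real. arccos (max (- 1) (min 1 t)))"
    by (intro continuous_on_arccos continuous_intros) auto
  then show ?thesis
    unfolding col_angle_def by (rule borel_measurable_continuous_on) measurable
qed

lemma borel_measurable_col_rot [measurable (raw)]:
  assumes [measurable]: "f \<in> borel_measurable M" "g \<in> borel_measurable M"
  shows "(\<lambda>x. col_rot k l (f x) (g x)) \<in> borel_measurable M"
  unfolding col_rot_def by measurable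

lemma borel_measurable_col_reduce [measurable (raw)]:
  assumes [measurable]: "f \<in> borel_measurable M"
  shows "(\<lambda>x. col_reduce k l (f x)) \<in> borel_measurable M"
  unfolding col_reduce_def by measurable

lemma mult_vec_nth: "(v *v axis k 1) $ i = (v $ i $ k :: real)"
  by (simp add: matrix_vector_mult_basis column_def)

lemma SO_inner: "v \<in> SO \<Longrightarrow> (v *v x) \<bullet> (v *v y) = x \<bullet> y"
  by (metis SO_mult_transpose(2) dot_lmul_matrix matrix_vector_mul_assoc matrix_vector_mul_lid
      transpose_matrix_vector)

lemma axis_inner: "axis k 1 \<bullet> x = (x :: real^'n) $ k"
  by (simp add: inner_axis inner_commute)

context
  fixes k l :: "'n::finite" and v :: "real^'n^'n"
  assumes kl: "k \<noteq> l" and v: "v \<in> SO"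
begin

lemma col_unit: "(v *v axis k 1) \<bullet> (v *v axis k 1) = 1"
  using v by (simp add: SO_inner inner_axis_axis)

lemma norm_col_rest: "(norm (col_rest k v))\<^sup>2 = 1 - (v $ k $ k)\<^sup>2"
proof -
  have e: "axis k 1 \<bullet> (v *v axis k 1) = v $ k $ k" "(v *v axis k 1) \<bullet> axis k 1 = v $ k $ k"
    "axis k 1 \<bullet> axis k (1::real) = 1"
    by (simp_all add: axis_inner inner_commute[of "v *v axis k 1"] mult_vec_nth inner_axis_axis)
  show ?thesis
    unfolding power2_norm_eq_inner col_rest_def inner_diff_left inner_diff_right inner_scaleR_left
      inner_scaleR_right col_unit e
    by (simp add: power2_eq_square)
qed

lemma diag_entry_bound: "- 1 \<le> v $ k $ k" "v $ k $ k \<le> 1"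
proof -
  have "(v $ k $ k)\<^sup>2 \<le> 1\<^sup>2"
    using norm_col_rest zero_le_power2[of "norm (col_rest k v)"] by simp
  then show "- 1 \<le> v $ k $ k" "v $ k $ k \<le> 1"
    using abs_le_square_iff[of "v $ k $ k" 1] by auto
qed

lemma orthonormal_col_dir: "orthonormal_pair (axis k 1) (col_dir k l v)"
proof -
  have "axis k 1 \<bullet> col_rest k v = 0"
    by (simp add: col_rest_def inner_simps axis_inner mult_vec_nth)
  then show ?thesis
    using kl by (auto simp: orthonormal_pair_def col_dir_def inner_axis_axis power2_norm_eq_inner[symmetric]
        power_divide power2_eq_square[symmetric])
qed

lemma cos_col_angle: "cos (col_angle k v) = v $ k $ k"
  using diag_entry_bound by (simp add: col_angle_def max_def min_def)

lemma sin_col_angle: "sin (col_angle k v) = norm (col_rest k v)"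
  using diag_entry_bound norm_col_rest
  by (simp add: col_angle_def max_def min_def sin_arccos norm_col_rest[symmetric])

text \<open>The column is the cosine of the angle times \<open>axis k 1\<close> plus its sine times
  \<open>col_dir k l v\<close>. The sine is the norm of the remainder because the angle lies in the
  interval from 0 to \<open>pi\<close>.\<close>

lemma col_rot_axis: "col_rot k l v 1 *v axis k 1 = v *v axis k 1"
proof -
  have on: "axis k 1 \<bullet> axis k (1::real) = 1" "col_dir k l v \<bullet> axis k 1 = 0"
    using orthonormal_col_dir by (auto simp: orthonormal_pair_def inner_commute)
  have "norm (col_rest k v) *\<^sub>R col_dir k l v = col_rest k v"
    by (simp add: col_dir_def)
  then show ?thesis
    by (simp add: col_rot_def plane_rot_mult_vec on cos_col_angle sin_col_angle)
      (simp add: col_rest_def algebra_simps)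
qed

lemma col_rot_SO: "col_rot k l v s \<in> SO"
  unfolding col_rot_def by (rule plane_rot_SO[OF orthonormal_col_dir])

lemma col_reduce_SO: "col_reduce k l v \<in> SO"
  unfolding col_reduce_def by (intro SO_mult SO_transpose col_rot_SO v)

lemma col_rot_reduce: "col_rot k l v 1 ** col_reduce k l v = v"
  using SO_mult_transpose(1)[OF col_rot_SO[of 1]] by (simp add: col_reduce_def matrix_mul_assoc)

lemma col_reduce_axis: "col_reduce k l v *v axis k 1 = axis k 1"
proof -
  have "col_reduce k l v *v axis k 1 = (transpose (col_rot k l v 1) ** col_rot k l v 1) *v axis k 1"
    unfolding col_reduce_def by (simp only: matrix_vector_mul_assoc[symmetric] col_rot_axis)
  then show ?thesis by (simp only: SO_mult_transpose(2)[OF col_rot_SO] matrix_vector_mul_lid)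
qed

context
  fixes f :: 'n
  assumes f: "f \<noteq> k" "f \<noteq> l" "v *v axis f 1 = axis f 1"
begin

text \<open>If \<open>v\<close> fixes \<open>axis f 1\<close>, its k-th column is orthogonal to that
  vector, and so is the whole plane of rotation. Reducing a further column therefore does not
  disturb the columns already in place; \<open>f \<noteq> l\<close> covers the default
  direction.\<close>

lemma col_dir_fixed: "col_dir k l v \<bullet> axis f 1 = 0"
proof -
  have "(v *v axis k 1) \<bullet> axis f 1 = (v *v axis k 1) \<bullet> (v *v axis f 1)"
    by (simp only: f)
  also have "\<dots> = 0"
    using f(1) by (simp only: SO_inner[OF v]) (simp add: inner_axis_axis)
  finally show ?thesis
    using f by (auto simp: col_dir_def col_rest_def inner_simps inner_axis_axis)
qed

lemma transpose_col_rot_fixed: "transpose (col_rot k l v s) *v axis f 1 = axis f 1"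
  using f col_dir_fixed
  by (simp only: col_rot_def transpose_plane_rot plane_rot_mult_vec) (simp add: inner_axis_axis)

lemma col_reduce_fixed: "col_reduce k l v *v axis f 1 = axis f 1"
  unfolding col_reduce_def matrix_vector_mul_assoc[symmetric] f(3) by (rule transpose_col_rot_fixed)

lemma plane_gen_fixed: "plane_gen (axis k 1) (col_dir k l v) *v axis f 1 = 0"
  using f col_dir_fixed by (simp add: plane_gen_mult_vec inner_axis_axis)

end

end

section \<open>Turning all columns simultaneously\<close>

text \<open>All plane rotations share the parameter \<open>s\<close>: each is carried out to the
  fraction \<open>s\<close> of its angle. The index \<open>l\<close> is the column left over after
  the reduction.\<close>

fun frame_curve :: "'n list \<Rightarrow> 'n \<Rightarrow> real^'n^'n \<Rightarrow> real \<Rightarrow> real^'n^'n" where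
  "frame_curve [] l v s = mat 1"
| "frame_curve (k # ks) l v s = col_rot k l v s ** frame_curve ks l (col_reduce k l v) s"

text \<open>This is \<open>SO_curve_mult\<close> unfolded along the product of plane
  rotations.\<close>

fun frame_velocity :: "'n list \<Rightarrow> 'n \<Rightarrow> real^'n^'n \<Rightarrow> real \<Rightarrow> real^'n^'n" where
  "frame_velocity [] l v s = 0"
| "frame_velocity (k # ks) l v s = col_angle k v *\<^sub>R plane_gen (axis k 1) (col_dir k l v) +
     col_rot k l v s ** frame_velocity ks l (col_reduce k l v) s ** transpose (col_rot k l v s)"

text \<open>The factor 2 is the squared norm of a plane generator.\<close>

fun frame_energy :: "'n list \<Rightarrow> 'n \<Rightarrow> real^'n^'n \<Rightarrow> real" where
  "frame_energy [] l v = 0"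
| "frame_energy (k # ks) l v = 2 * (col_angle k v)\<^sup>2 + frame_energy ks l (col_reduce k l v)"

lemma borel_measurable_frame_curve [measurable (raw)]:
  "f \<in> borel_measurable M \<Longrightarrow> g \<in> borel_measurable M \<Longrightarrow>
    (\<lambda>x. frame_curve ks l (f x) (g x)) \<in> borel_measurable M"
  by (induction ks arbitrary: f) (simp_all add: borel_measurable_matrix_mult borel_measurable_col_rot borel_measurable_col_reduce)

lemma borel_measurable_frame_velocity [measurable (raw)]:
  assumes "f \<in> borel_measurable M" and [measurable]: "g \<in> borel_measurable M"
  shows "(\<lambda>x. frame_velocity ks l (f x) (g x)) \<in> borel_measurable M"
  using assms(1)
proof (induction ks arbitrary: f)
  case (Cons k ks)
  note Cons.prems[measurable]
  have [measurable]: "(\<lambda>x. frame_velocity ks l (col_reduce k l (f x)) (g x)) \<in> borel_measurable M"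
    by (rule Cons.IH) measurable
  show ?case unfolding frame_velocity.simps by measurable
qed simp

lemma borel_measurable_frame_energy [measurable (raw)]:
  "f \<in> borel_measurable M \<Longrightarrow> (\<lambda>x. frame_energy ks l (f x)) \<in> borel_measurable M"
proof (induction ks arbitrary: f)
  case (Cons k ks)
  note Cons.prems[measurable]
  have [measurable]: "(\<lambda>x. frame_energy ks l (col_reduce k l (f x))) \<in> borel_measurable M"
    by (rule Cons.IH) measurable
  show ?case unfolding frame_energy.simps by measurable
qed simp

lemma frame_energy_nonneg: "0 \<le> frame_energy ks l v"
  by (induction ks arbitrary: v) auto

lemma frame_curve_0: "frame_curve ks l v 0 = mat 1"
  by (induction ks arbitrary: v) (simp_all add: col_rot_def)

lemma SO_curve_frame:
  assumes "l \<notin> set ks" "v \<in> SO"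
  shows "SO_curve (frame_curve ks l v) (frame_velocity ks l v)"
  using assms
proof (induction ks arbitrary: v)
  case Nil
  have "frame_curve [] l v = (\<lambda>s. mat 1)" "frame_velocity [] l v = (\<lambda>s. 0)" by auto
  then show ?case by (simp add: SO_curve_const)
next
  case (Cons k ks)
  then have kl: "k \<noteq> l" by auto
  have "SO_curve (\<lambda>t. plane_rot (axis k 1) (col_dir k l v) (t * col_angle k v))
      (\<lambda>t. col_angle k v *\<^sub>R plane_gen (axis k 1) (col_dir k l v))"
    by (rule SO_curve_plane_rot[OF orthonormal_col_dir[OF kl Cons.prems(2)] smooth_const])
      (auto intro!: derivative_eq_intros simp: has_real_derivative_iff_has_vector_derivative[symmetric])
  then have "SO_curve (col_rot k l v) (\<lambda>t. col_angle k v *\<^sub>R plane_gen (axis k 1) (col_dir k l v))"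
    unfolding col_rot_def .
  from SO_curve_mult[OF this Cons.IH[OF _ col_reduce_SO[OF kl Cons.prems(2)]]] Cons.prems(1)
  show ?case by (simp add: fun_eq_iff[THEN iffD2, OF frame_curve.simps(2)[THEN allI]]
      fun_eq_iff[THEN iffD2, OF frame_velocity.simps(2)[THEN allI]])
qed

text \<open>Once all listed columns are reduced, every basis vector other than
  \<open>axis l 1\<close> is fixed. Orthogonality then leaves only the sign of the last column open,
  and the determinant decides it.\<close>

lemma frame_curve_1:
  assumes "l \<notin> set ks" "distinct ks" "v \<in> SO"
    and "\<And>f. f \<notin> set ks \<Longrightarrow> f \<noteq> l \<Longrightarrow> v *v axis f 1 = axis f 1"
  shows "frame_curve ks l v 1 = v"
  using assms
proof (induction ks arbitrary: v)
  case Nil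
  have fixed: "v $ i $ j = (if i = j then 1 else 0)" if "j \<noteq> l" for i j
    using Nil.prems(4)[OF _ that] mult_vec_nth[of v j i] by (simp add: axis_def)
  have orth: "v $ j $ l = 0" if "j \<noteq> l" for j
  proof -
    have "v $ j $ l = axis j 1 \<bullet> (v *v axis l 1)" by (simp add: axis_inner mult_vec_nth)
    also have "\<dots> = (v *v axis j 1) \<bullet> (v *v axis l 1)" using Nil.prems(4)[OF _ that] by simp
    also have "\<dots> = 0" using that by (simp add: SO_inner[OF Nil.prems(3)] inner_axis_axis)
    finally show ?thesis .
  qed
  have "det v = (\<Prod>i\<in>UNIV. v $ i $ i)"
    by (rule det_diagonal) (metis fixed orth)
  also have "\<dots> = (\<Prod>i\<in>UNIV. if i = l then v $ l $ l else 1)"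
    by (intro prod.cong) (auto simp: fixed)
  finally have "v $ l $ l = 1"
    using Nil.prems(3) by (simp add: SO_def)
  then have "v $ i $ j = mat 1 $ i $ j" for i j
    using fixed[of j i] orth[of i] by (cases "j = l") (auto simp: mat_def)
  then show ?case by (simp add: vec_eq_iff)
next
  case (Cons k ks)
  then have kl: "k \<noteq> l" by auto
  have "frame_curve ks l (col_reduce k l v) 1 = col_reduce k l v"
  proof (rule Cons.IH)
    fix f assume f: "f \<notin> set ks" "f \<noteq> l"
    show "col_reduce k l v *v axis f 1 = axis f 1"
    proof (cases "f = k")
      case True
      then show ?thesis using col_reduce_axis[OF kl Cons.prems(3)] by simp
    next
      case False
      with f Cons.prems(4) show ?thesis by (intro col_reduce_fixed kl Cons.prems(3)) auto
    qed
  qed (use Cons.prems col_reduce_SO[OF kl Cons.prems(3)] in auto)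
  then show ?case using col_rot_reduce[OF kl Cons.prems(3)] by simp
qed

text \<open>All planes involved are orthogonal to a basis vector that is already in place. This
  makes the velocity of the later rotations orthogonal to the generator of the current one.\<close>

lemma frame_velocity_fixed:
  assumes "l \<notin> set ks" "v \<in> SO" "f \<notin> set ks" "f \<noteq> l" "v *v axis f 1 = axis f 1"
  shows "frame_velocity ks l v s *v axis f 1 = 0"
  using assms
proof (induction ks arbitrary: v)
  case (Cons k ks)
  then have kl: "k \<noteq> l" and fk: "f \<noteq> k" by auto
  note fix' = kl Cons.prems(2) fk Cons.prems(4,5)
  have "frame_velocity ks l (col_reduce k l v) s *v axis f 1 = 0"
    using Cons.prems by (intro Cons.IH col_reduce_SO[OF kl] col_reduce_fixed[OF fix']) auto
  then show ?case
    unfolding frame_velocity.simps matrix_vector_mult_add_rdistrib scaleR_matrix_vector_assoc[symmetric]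
      matrix_vector_mul_assoc[symmetric] transpose_col_rot_fixed[OF fix'] plane_gen_fixed[OF fix']
    by simp
qed simp

text \<open>The cross term of \<open>norm_plane_gen_add_conj\<close> vanishes, as the remaining
  velocity annihilates \<open>axis k 1\<close>; so squares simply add. In particular the speed is
  constant in \<open>s\<close>.\<close>

lemma norm_frame_velocity:
  assumes "l \<notin> set ks" "distinct ks" "v \<in> SO" "s \<in> {0..1}"
  shows "(norm (frame_velocity ks l v s))\<^sup>2 = frame_energy ks l v"
  using assms
proof (induction ks arbitrary: v)
  case (Cons k ks)
  then have kl: "k \<noteq> l" by auto
  let ?C = "frame_velocity ks l (col_reduce k l v) s"
  have red: "col_reduce k l v \<in> SO" by (rule col_reduce_SO[OF kl Cons.prems(3)])
  have "transpose ?C = - ?C"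
    using SO_curve_frame[OF _ red, of l ks] Cons.prems by (auto simp: SO_curve_def)
  moreover have "?C *v axis k 1 = 0"
    using Cons.prems kl by (intro frame_velocity_fixed red col_reduce_axis) auto
  ultimately show ?case
    using norm_plane_gen_add_conj[OF orthonormal_col_dir[OF kl Cons.prems(3)] _ col_rot_def[of k l v s],
        of ?C "col_angle k v"] Cons.IH[OF _ _ red] Cons.prems
    by simp
qed simp

subsection \<open>Random curves and transportation cost\<close>

lemma space_borel_SO [simp]: "space borel_SO = SO"
  by (simp add: borel_SO_def space_restrict_space)

lemma borel_measurable_id: "(\<lambda>x. x) \<in> borel_measurable borel"
  by simp

lemma measurable_borel_SO_iff:
  "f \<in> M \<rightarrow>\<^sub>M borel_SO \<longleftrightarrow> f \<in> borel_measurable M \<and> f \<in> space M \<rightarrow> SO"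
  by (auto simp: borel_SO_def measurable_restrict_space2_iff)

lemma measurable_borel_SO_D: "f \<in> M \<rightarrow>\<^sub>M borel_SO \<Longrightarrow> f \<in> borel_measurable M"
  by (simp add: measurable_borel_SO_iff)

lemma measurable_from_borel_SO:
  assumes "sets N = sets borel_SO" "f \<in> borel_measurable borel"
  shows "f \<in> borel_measurable N"
  unfolding measurable_cong_sets[OF assms(1) refl] unfolding borel_SO_def
  by (rule measurable_restrict_space1[OF assms(2)])

section \<open>Sign changes of columns and the mean initial energy\<close>

text \<open>Right multiplication by it changes the sign of columns \<open>k\<close> and
  \<open>l\<close>. Changing column \<open>k\<close> alone would reverse the sign of the
  determinant.\<close>

abbreviation flip :: "'n \<Rightarrow> 'n \<Rightarrow> real^'n^'n" where
  "flip k l \<equiv> plane_rot (axis k 1) (axis l 1) pi"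

lemma flip_axis: "k \<noteq> l \<Longrightarrow> flip k l *v axis k 1 = - axis k 1"
  "j \<noteq> k \<Longrightarrow> j \<noteq> l \<Longrightarrow> flip k l *v axis j 1 = axis j 1"
  by (simp_all add: plane_rot_mult_vec inner_axis_axis vec_eq_iff)

lemma flip_SO: "k \<noteq> l \<Longrightarrow> flip k l \<in> SO"
  by (intro plane_rot_SO orthonormal_pair_axis)

lemma col_angle_bounds: "0 \<le> col_angle k v" "col_angle k v \<le> pi"
  unfolding col_angle_def by (auto intro!: arccos_lbound arccos_ubound)

lemma col_angle_flip:
  assumes "k \<noteq> l" "v \<in> SO"
  shows "col_angle k (v ** flip k l) = pi - col_angle k v"
proof -
  have "(v ** flip k l) $ k $ k = ((v ** flip k l) *v axis k 1) $ k"
    by (simp only: mult_vec_nth)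
  also have "\<dots> = (v *v (- axis k 1)) $ k"
    by (simp only: matrix_vector_mul_assoc[symmetric] flip_axis(1)[OF assms(1)])
  also have "v *v (- axis k 1) = - (v *v axis k 1)"
    using matrix_vector_mult_diff_distrib[of v 0 "axis k 1"] by simp
  finally have "(v ** flip k l) $ k $ k = - (v $ k $ k)"
    by (simp add: mult_vec_nth)
  then show ?thesis
    using diag_entry_bound[OF assms] by (simp add: col_angle_def max_def min_def arccos_minus)
qed

text \<open>The sign change leaves the k-th column alone, and the reducing rotation depends on this
  column only and acts from the left. The symmetry in the other columns thus survives the
  reduction.\<close>

lemma col_reduce_flip:
  assumes "j \<noteq> k" "k \<noteq> l"
  shows "col_reduce k l (v ** flip j l) = col_reduce k l v ** flip j l"
proof -
  have "flip j l *v axis k 1 = axis k 1"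
    using assms by (intro flip_axis) auto
  then have "(v ** flip j l) *v axis k 1 = v *v axis k 1"
    by (simp only: matrix_vector_mul_assoc[symmetric])
  moreover from this have "(v ** flip j l) $ k $ k = v $ k $ k"
    by (metis mult_vec_nth)
  ultimately have "col_rest k (v ** flip j l) = col_rest k v" "col_angle k (v ** flip j l) = col_angle k v"
    by (simp_all add: col_rest_def col_angle_def)
  then show ?thesis
    by (simp add: col_reduce_def col_rot_def col_dir_def matrix_mul_assoc)
qed

text \<open>Invariance under sign changes gives the angle and its supplement the same law, which
  bounds the mean of each summand. A general measure \<open>N\<close> stands in place of the Haar
  measure because the induction passes to the law of the reduced matrix, which keeps the remaining
  sign symmetries.\<close>

lemma nn_integral_frame_energy:
  fixes N :: "(real^'n^'n) measure"
  assumes "l \<notin> set ks" "distinct ks" "sets N = sets borel_SO"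
    and "\<And>k. k \<in> set ks \<Longrightarrow> distr N borel_SO (\<lambda>v. v ** flip k l) = N"
  shows "(\<integral>\<^sup>+v. ennreal (frame_energy ks l v) \<partial>N) \<le> ennreal (pi\<^sup>2 * length ks) * emeasure N SO"
  using assms
proof (induction ks arbitrary: N)
  case (Cons k ks)
  then have kl: "k \<noteq> l" by auto
  note sets_N [measurable_cong] = Cons.prems(3)
  have space_N: "space N = SO" using sets_eq_imp_space_eq[OF sets_N] by simp
  note from_SO [measurable (raw)] = measurable_from_borel_SO[OF sets_N]
  have flip_meas: "(\<lambda>v. v ** flip j l) \<in> N \<rightarrow>\<^sub>M borel_SO" if "j \<noteq> l" for j
    using that by (auto simp: measurable_borel_SO_iff space_N intro!: SO_mult flip_SO from_SO)
  have red_meas: "col_reduce k l \<in> N \<rightarrow>\<^sub>M borel_SO"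
    using kl by (auto simp: measurable_borel_SO_iff space_N intro!: col_reduce_SO from_SO borel_measurable_col_reduce)
  define N' where "N' = distr N borel_SO (col_reduce k l)"
  have angle: "(\<integral>\<^sup>+v. ennreal (2 * (col_angle k v)\<^sup>2) \<partial>N) \<le> ennreal (pi\<^sup>2) * emeasure N SO"
  proof -
    have m: "(\<lambda>v. ennreal ((col_angle k v)\<^sup>2)) \<in> borel_measurable borel" by measurable
    have "(\<integral>\<^sup>+v. ennreal ((col_angle k v)\<^sup>2) \<partial>N) = (\<integral>\<^sup>+v. ennreal ((col_angle k v)\<^sup>2) \<partial>distr N borel_SO (\<lambda>v. v ** flip k l))"
      using Cons.prems(4) by simp
    also have "\<dots> = (\<integral>\<^sup>+v. ennreal ((col_angle k (v ** flip k l))\<^sup>2) \<partial>N)"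
      using measurable_from_borel_SO[OF refl m] by (subst nn_integral_distr[OF flip_meas[OF kl]]) simp_all
    also have "\<dots> = (\<integral>\<^sup>+v. ennreal ((pi - col_angle k v)\<^sup>2) \<partial>N)"
      using kl by (intro nn_integral_cong) (simp add: col_angle_flip space_N)
    \<comment> \<open>Of the two copies of the squared angle, one is replaced by its image under the
      sign change.\<close>
    finally have "(\<integral>\<^sup>+v. ennreal (2 * (col_angle k v)\<^sup>2) \<partial>N) =
        (\<integral>\<^sup>+v. ennreal ((col_angle k v)\<^sup>2) \<partial>N) + (\<integral>\<^sup>+v. ennreal ((pi - col_angle k v)\<^sup>2) \<partial>N)"
      by (subst ennreal_mult, simp, simp, subst nn_integral_cmult) (auto intro: from_SO m simp: mult_2)
    also have "\<dots> = (\<integral>\<^sup>+v. ennreal ((col_angle k v)\<^sup>2) + ennreal ((pi - col_angle k v)\<^sup>2) \<partial>N)"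
      by (intro nn_integral_add[symmetric] from_SO) measurable
    also have "\<dots> \<le> (\<integral>\<^sup>+v. ennreal (pi\<^sup>2) \<partial>N)"
    proof (intro nn_integral_mono)
      fix v :: "real^'n^'n"
      have "0 \<le> col_angle k v * (pi - col_angle k v)"
        using col_angle_bounds[of k v] by simp
      then have "(col_angle k v)\<^sup>2 + (pi - col_angle k v)\<^sup>2 \<le> pi\<^sup>2"
        by (simp add: power2_eq_square algebra_simps)
      then show "ennreal ((col_angle k v)\<^sup>2) + ennreal ((pi - col_angle k v)\<^sup>2) \<le> ennreal (pi\<^sup>2)"
        by (simp add: ennreal_plus[symmetric] del: ennreal_plus)
    qed
    finally show ?thesis by (simp add: space_N)
  qed
  have "(\<integral>\<^sup>+v. ennreal (frame_energy ks l (col_reduce k l v)) \<partial>N) = (\<integral>\<^sup>+v. ennreal (frame_energy ks l v) \<partial>N')"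
  proof -
    have "(\<lambda>v. ennreal (frame_energy ks l v)) \<in> borel_measurable borel_SO"
      by (intro measurable_from_borel_SO[OF refl]) measurable
    then show ?thesis unfolding N'_def by (subst nn_integral_distr[OF red_meas]) simp_all
  qed
  also have "\<dots> \<le> ennreal (pi\<^sup>2 * length ks) * emeasure N' SO"
  proof (rule Cons.IH)
    fix j assume "j \<in> set ks"
    then have j: "j \<noteq> k" "j \<noteq> l" "j \<in> set (k # ks)" using Cons.prems by auto
    have fm: "(\<lambda>v. v ** flip j l) \<in> borel_SO \<rightarrow>\<^sub>M borel_SO"
      using flip_meas[OF j(2)] by (simp add: measurable_cong_sets[OF sets_N refl])
    have rm: "col_reduce k l \<in> borel_SO \<rightarrow>\<^sub>M borel_SO"
      using red_meas by (simp add: measurable_cong_sets[OF sets_N refl])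
    have "distr N' borel_SO (\<lambda>v. v ** flip j l) = distr N borel_SO (\<lambda>v. col_reduce k l v ** flip j l)"
      unfolding N'_def by (simp add: distr_distr[OF fm red_meas] comp_def)
    also have "\<dots> = distr N borel_SO (\<lambda>v. col_reduce k l (v ** flip j l))"
      using j kl by (simp add: col_reduce_flip)
    also have "\<dots> = distr (distr N borel_SO (\<lambda>v. v ** flip j l)) borel_SO (col_reduce k l)"
      by (simp add: distr_distr[OF rm flip_meas[OF j(2)]] comp_def)
    also have "\<dots> = N'"
      using Cons.prems(4)[OF j(3)] by (simp add: N'_def)
    finally show "distr N' borel_SO (\<lambda>v. v ** flip j l) = N'" .
  qed (use Cons.prems in \<open>auto simp: N'_def\<close>)
  also have "emeasure N' SO = emeasure N SO"
  proof -
    have "col_reduce k l -` SO \<inter> SO = SO" using col_reduce_SO[OF kl] by auto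
    then show ?thesis
      unfolding N'_def using sets.top[of borel_SO] by (subst emeasure_distr[OF red_meas]) (auto simp: space_N)
  qed
  finally have rest: "(\<integral>\<^sup>+v. ennreal (frame_energy ks l (col_reduce k l v)) \<partial>N) \<le> ennreal (pi\<^sup>2 * length ks) * emeasure N SO" .
  have "(\<integral>\<^sup>+v. ennreal (frame_energy (k # ks) l v) \<partial>N) =
      (\<integral>\<^sup>+v. ennreal (2 * (col_angle k v)\<^sup>2) + ennreal (frame_energy ks l (col_reduce k l v)) \<partial>N)"
    by (simp add: frame_energy_nonneg)
  also have "\<dots> = (\<integral>\<^sup>+v. ennreal (2 * (col_angle k v)\<^sup>2) \<partial>N) + (\<integral>\<^sup>+v. ennreal (frame_energy ks l (col_reduce k l v)) \<partial>N)"
    by (intro nn_integral_add from_SO) measurable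
  also have "\<dots> \<le> ennreal (pi\<^sup>2) * emeasure N SO + ennreal (pi\<^sup>2 * length ks) * emeasure N SO"
    by (intro add_mono angle rest)
  also have "\<dots> = ennreal (pi\<^sup>2 * length (k # ks)) * emeasure N SO"
  proof -
    have "ennreal (pi\<^sup>2 * length (k # ks)) = ennreal (pi\<^sup>2) + ennreal (pi\<^sup>2 * length ks)"
      by (simp add: ennreal_plus[symmetric] algebra_simps del: ennreal_plus)
    then show ?thesis by (simp only: distrib_right)
  qed
  finally show ?case .
qed simp

section \<open>Energy as a random variable and random curves as couplings\<close>

lemma energy_eq_lebesgue:
  assumes "smooth B"
  shows "energy B = (LINT s|lborel. indicator {0..1} s * (norm (B s))\<^sup>2)"
proof -
  have "set_integrable lborel {0..1} (\<lambda>s. (norm (B s))\<^sup>2)"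
    unfolding set_integrable_def
    by (intro borel_integrable_compact continuous_intros smooth_continuous_on[OF assms]) simp
  then show ?thesis
    using set_borel_integral_eq_integral(2)[of "{0..1}" "\<lambda>s. (norm (B s))\<^sup>2"]
    by (simp add: energy_def set_lebesgue_integral_def)
qed

text \<open>As a Lebesgue integral the energy is a parameter integral of a jointly measurable
  function.\<close>

lemma borel_measurable_energy:
  assumes B: "(\<lambda>(\<omega>, s). B \<omega> s) \<in> borel_measurable (M \<Otimes>\<^sub>M borel)" and s: "\<And>\<omega>. \<omega> \<in> space M \<Longrightarrow> smooth (B \<omega>)"
  shows "(\<lambda>\<omega>. energy (B \<omega>)) \<in> borel_measurable M"
proof -
  have "(\<lambda>\<omega>. LINT s|lborel. indicator {0..1} s * (norm (B \<omega> s))\<^sup>2) \<in> borel_measurable M"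
    using B by measurable
  also have "?this \<longleftrightarrow> ?thesis"
    by (intro measurable_cong) (simp add: energy_eq_lebesgue s)
  finally show ?thesis .
qed

lemma emeasure_distr_indicator:
  assumes T: "T \<in> M \<rightarrow>\<^sub>M N" and S: "S \<in> sets N"
  shows "emeasure (distr M N T) S = (\<integral>\<^sup>+x. indicator S (T x) \<partial>M)"
proof -
  have "emeasure (distr M N T) S = (\<integral>\<^sup>+x. indicator S x \<partial>distr M N T)"
    using S by simp
  also have "\<dots> = (\<integral>\<^sup>+x. indicator S (T x) \<partial>M)"
    using S by (intro nn_integral_distr T) simp
  finally show ?thesis .
qed

text \<open>A coupling of \<open>\<mu>\<close> and \<open>\<nu>\<close> by the two ends of a random
  curve, with mean energy at most \<open>E\<close>. Joint measurability of \<open>B\<close> lets its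
  entries be integrated along the curve into random angles.\<close>

definition random_curve ::
  "'w measure \<Rightarrow> ('w \<Rightarrow> real \<Rightarrow> real^'n^'n) \<Rightarrow> ('w \<Rightarrow> real \<Rightarrow> real^'n^'n) \<Rightarrow>
    (real^'n^'n) measure \<Rightarrow> (real^'n^'n) measure \<Rightarrow> real \<Rightarrow> bool" where
  "random_curve M \<gamma> B \<mu> \<nu> E \<longleftrightarrow> prob_space M \<and>
     (\<forall>\<omega>\<in>space M. SO_curve (\<gamma> \<omega>) (B \<omega>)) \<and>
     (\<lambda>(\<omega>, s). B \<omega> s) \<in> borel_measurable (M \<Otimes>\<^sub>M borel) \<and>
     (\<lambda>\<omega>. \<gamma> \<omega> 0) \<in> M \<rightarrow>\<^sub>M borel_SO \<and> (\<lambda>\<omega>. \<gamma> \<omega> 1) \<in> M \<rightarrow>\<^sub>M borel_SO \<and>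
     distr M borel_SO (\<lambda>\<omega>. \<gamma> \<omega> 0) = \<mu> \<and> distr M borel_SO (\<lambda>\<omega>. \<gamma> \<omega> 1) = \<nu> \<and>
     (\<integral>\<^sup>+\<omega>. ennreal (energy (B \<omega>)) \<partial>M) \<le> ennreal E"

lemma wasserstein2_le_random_curve:
  assumes rc: "random_curve M \<gamma> B \<mu> \<nu> E" and E: "0 \<le> E"
  shows "wasserstein2 riem_dist \<mu> \<nu> \<le> sqrt E"
proof -
  interpret prob_space M using rc by (simp add: random_curve_def)
  define \<eta> where "\<eta> = distr M (\<mu> \<Otimes>\<^sub>M \<nu>) (\<lambda>\<omega>. (\<gamma> \<omega> 0, \<gamma> \<omega> 1))"
  have sets [measurable_cong]: "sets \<mu> = sets borel_SO" "sets \<nu> = sets borel_SO"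
    using rc by (auto simp: random_curve_def)
  have m [measurable]: "(\<lambda>\<omega>. \<gamma> \<omega> 0) \<in> M \<rightarrow>\<^sub>M borel_SO" "(\<lambda>\<omega>. \<gamma> \<omega> 1) \<in> M \<rightarrow>\<^sub>M borel_SO"
    using rc by (auto simp: random_curve_def)
  have pm [measurable]: "(\<lambda>\<omega>. (\<gamma> \<omega> 0, \<gamma> \<omega> 1)) \<in> M \<rightarrow>\<^sub>M (\<mu> \<Otimes>\<^sub>M \<nu>)" by measurable
  have "distr \<eta> \<mu> fst = distr M \<mu> (\<lambda>\<omega>. \<gamma> \<omega> 0)" "distr \<eta> \<nu> snd = distr M \<nu> (\<lambda>\<omega>. \<gamma> \<omega> 1)"
    unfolding \<eta>_def by (simp_all add: distr_distr comp_def)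
  moreover have "distr M \<mu> (\<lambda>\<omega>. \<gamma> \<omega> 0) = distr M borel_SO (\<lambda>\<omega>. \<gamma> \<omega> 0)"
    "distr M \<nu> (\<lambda>\<omega>. \<gamma> \<omega> 1) = distr M borel_SO (\<lambda>\<omega>. \<gamma> \<omega> 1)"
    by (intro distr_cong refl sets)+
  ultimately have \<eta>: "\<eta> \<in> couplings \<mu> \<nu>"
    using rc prob_space_distr[OF pm] by (auto simp: couplings_def random_curve_def \<eta>_def)
  have "wasserstein2 riem_dist \<mu> \<nu> \<le> sqrt (\<integral>z. (riem_dist (fst z) (snd z))\<^sup>2 \<partial>\<eta>)"
    unfolding wasserstein2_def
    by (intro cINF_lower[OF _ \<eta>] bdd_belowI[of _ 0]) (auto intro!: integral_nonneg)
  also have "(\<integral>z. (riem_dist (fst z) (snd z))\<^sup>2 \<partial>\<eta>) \<le> E"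
  \<comment> \<open>Integrability provides the measurability of the cost. In the other case the
    Bochner integral is 0 by convention, below \<open>E\<close>.\<close>
  proof (cases "integrable \<eta> (\<lambda>z. (riem_dist (fst z) (snd z))\<^sup>2)")
    case True
    have "ennreal (\<integral>z. (riem_dist (fst z) (snd z))\<^sup>2 \<partial>\<eta>) = (\<integral>\<^sup>+z. ennreal ((riem_dist (fst z) (snd z))\<^sup>2) \<partial>\<eta>)"
      by (intro nn_integral_eq_integral[symmetric] True) auto
    also have "\<dots> = (\<integral>\<^sup>+\<omega>. ennreal ((riem_dist (\<gamma> \<omega> 0) (\<gamma> \<omega> 1))\<^sup>2) \<partial>M)"
      using True unfolding \<eta>_def by (subst nn_integral_distr[OF pm]) auto
    also have "\<dots> \<le> (\<integral>\<^sup>+\<omega>. ennreal (energy (B \<omega>)) \<partial>M)"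
      using rc by (intro nn_integral_mono ennreal_leI riem_dist_le_energy) (auto simp: random_curve_def)
    also have "\<dots> \<le> ennreal E" using rc by (simp add: random_curve_def)
    finally show ?thesis using E by (simp add: ennreal_le_iff)
  next
    case False
    then show ?thesis using E by (simp add: not_integrable_integral_eq)
  qed
  finally show ?thesis by simp
qed

text \<open>Moves a random curve to another sample space by an encoding with a measurable left
  inverse; this keeps the type of the sample space fixed during the iteration.\<close>

lemma random_curve_recode:
  assumes rc: "random_curve M \<gamma> B \<mu> \<nu> E"
    and enc [measurable]: "enc \<in> M \<rightarrow>\<^sub>M N" and dec [measurable]: "dec \<in> N \<rightarrow>\<^sub>M M"
    and inv: "\<And>\<omega>. \<omega> \<in> space M \<Longrightarrow> dec (enc \<omega>) = \<omega>"
  shows "random_curve (distr M N enc) (\<lambda>z. \<gamma> (dec z)) (\<lambda>z. B (dec z)) \<mu> \<nu> E"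
proof -
  interpret prob_space M using rc by (simp add: random_curve_def)
  have m [measurable]: "(\<lambda>\<omega>. \<gamma> \<omega> 0) \<in> M \<rightarrow>\<^sub>M borel_SO" "(\<lambda>\<omega>. \<gamma> \<omega> 1) \<in> M \<rightarrow>\<^sub>M borel_SO"
    and B [measurable]: "(\<lambda>(\<omega>, s). B \<omega> s) \<in> borel_measurable (M \<Otimes>\<^sub>M borel)"
    using rc by (auto simp: random_curve_def)
  have "(\<lambda>\<omega>. energy (B \<omega>)) \<in> borel_measurable M"
    using rc by (intro borel_measurable_energy B) (auto simp: random_curve_def SO_curve_def)
  then have "(\<lambda>z. energy (B (dec z))) \<in> borel_measurable N" by measurable
  moreover have "(\<lambda>(\<omega>, s). B (dec \<omega>) s) \<in> borel_measurable (N \<Otimes>\<^sub>M borel)" by measurable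
  moreover have "dec z \<in> space M" if "z \<in> space N" for z
    by (rule measurable_space[OF dec that])
  moreover have "distr (distr M N enc) borel_SO (\<lambda>z. \<gamma> (dec z) t) = distr M borel_SO (\<lambda>\<omega>. \<gamma> \<omega> t)"
    if "t = 0 \<or> t = 1" for t
    using that by (auto simp: distr_distr comp_def inv intro!: distr_cong)
  ultimately show ?thesis
    using rc prob_space_distr[OF enc] unfolding random_curve_def
    by (auto simp: nn_integral_distr inv cong: nn_integral_cong)
qed

text \<open>For independent \<open>x\<close> with law \<open>\<mu>\<close> and Haar distributed
  \<open>u\<close>, the curve leads from \<open>x\<close> to \<open>u ** x\<close>. Right invariance
  gives its end the Haar law, and its energy depends on \<open>u\<close> alone.\<close>

lemma random_curve_initial:
  fixes \<mu> H :: "(real^'n^'n) measure"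
  assumes \<mu>: "borel_prob \<mu>" and H: "haar_prob H"
  shows "\<exists>\<gamma> B. random_curve (\<mu> \<Otimes>\<^sub>M H) \<gamma> B \<mu> H (pi\<^sup>2 * CARD('n))"
proof -
  interpret \<mu>: prob_space \<mu> using \<mu> by (simp add: borel_prob_def)
  interpret H: prob_space H using H by (simp add: borel_prob_def haar_prob_def)
  interpret P: pair_prob_space \<mu> H ..
  have sets [measurable_cong]: "sets \<mu> = sets borel_SO" "sets H = sets borel_SO"
    using \<mu> H by (auto simp: borel_prob_def haar_prob_def)
  have space: "space \<mu> = SO" "space H = SO"
    using sets_eq_imp_space_eq[OF sets(1)] sets_eq_imp_space_eq[OF sets(2)] by simp_all
  obtain l :: 'n where True by simp
  obtain ks where ks: "set ks = UNIV - {l}" "distinct ks"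
    using finite_distinct_list[of "UNIV - {l}"] by auto
  define \<gamma> where "\<gamma> = (\<lambda>(x, u) s. frame_curve ks l u s ** (x :: real^'n^'n))"
  define B where "B = (\<lambda>(x :: real^'n^'n, u :: real^'n^'n). frame_velocity ks l u)"
  have u_meas [measurable]: "(\<lambda>z. snd z) \<in> borel_measurable (\<mu> \<Otimes>\<^sub>M H)"
    by (rule measurable_compose[OF measurable_snd measurable_from_borel_SO[OF sets(2) borel_measurable_id]])
  have x_meas [measurable]: "(\<lambda>z. fst z) \<in> borel_measurable (\<mu> \<Otimes>\<^sub>M H)"
    by (rule measurable_compose[OF measurable_fst measurable_from_borel_SO[OF sets(1) borel_measurable_id]])
  have curve: "SO_curve (\<gamma> z) (B z)" if "z \<in> space (\<mu> \<Otimes>\<^sub>M H)" for z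
  proof -
    obtain x u where z: "z = (x, u)" "x \<in> SO" "u \<in> SO"
      using \<open>z \<in> _\<close> by (auto simp: space_pair_measure space)
    have "l \<notin> set ks" using ks(1) by simp
    from SO_curve_mult[OF SO_curve_frame[OF this z(3)] SO_curve_const[OF z(2)]]
    show ?thesis
      unfolding z(1) \<gamma>_def B_def prod.case
        bounded_bilinear.zero_left[OF bounded_bilinear_matrix_mult]
        bounded_bilinear.zero_right[OF bounded_bilinear_matrix_mult] add_0_right .
  qed
  have end_points: "\<gamma> z 0 = fst z" "\<gamma> z 1 = snd z ** fst z" if "z \<in> space (\<mu> \<Otimes>\<^sub>M H)" for z
  proof -
    obtain x u where z: "z = (x, u)" "u \<in> SO"
      using \<open>z \<in> _\<close> by (auto simp: space_pair_measure space)
    have "frame_curve ks l u 1 = u"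
      using ks by (intro frame_curve_1 z) auto
    then show "\<gamma> z 0 = fst z" "\<gamma> z 1 = snd z ** fst z"
      by (simp_all add: \<gamma>_def z frame_curve_0)
  qed
  have meas: "(\<lambda>z. \<gamma> z t) \<in> \<mu> \<Otimes>\<^sub>M H \<rightarrow>\<^sub>M borel_SO" if "t \<in> {0..1}" for t
    unfolding measurable_borel_SO_iff
  proof
    show "(\<lambda>z. \<gamma> z t) \<in> borel_measurable (\<mu> \<Otimes>\<^sub>M H)"
      unfolding \<gamma>_def split_beta by measurable
    show "(\<lambda>z. \<gamma> z t) \<in> space (\<mu> \<Otimes>\<^sub>M H) \<rightarrow> SO"
      using curve that by (auto simp: SO_curve_def)
  qed
  have "distr (\<mu> \<Otimes>\<^sub>M H) borel_SO (\<lambda>z. \<gamma> z 0) = distr (\<mu> \<Otimes>\<^sub>M H) \<mu> fst"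
    by (intro distr_cong) (simp_all add: sets end_points)
  then have law0: "distr (\<mu> \<Otimes>\<^sub>M H) borel_SO (\<lambda>z. \<gamma> z 0) = \<mu>"
    by (simp add: H.distr_pair_fst)
  have law1: "distr (\<mu> \<Otimes>\<^sub>M H) borel_SO (\<lambda>z. \<gamma> z 1) = H"
  proof (rule measure_eqI)
    fix S assume "S \<in> sets (distr (\<mu> \<Otimes>\<^sub>M H) borel_SO (\<lambda>z. \<gamma> z 1))"
    then have S [measurable]: "S \<in> sets borel_SO" by simp
    have mi: "(\<lambda>z. indicator S (\<gamma> z 1) :: ennreal) \<in> borel_measurable (\<mu> \<Otimes>\<^sub>M H)"
      by (rule measurable_compose[OF meas borel_measurable_indicator[OF S]]) simp
    have "emeasure (distr (\<mu> \<Otimes>\<^sub>M H) borel_SO (\<lambda>z. \<gamma> z 1)) S = (\<integral>\<^sup>+z. indicator S (\<gamma> z 1) \<partial>(\<mu> \<Otimes>\<^sub>M H))"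
      by (intro emeasure_distr_indicator meas S) simp
    also have "\<dots> = (\<integral>\<^sup>+x. \<integral>\<^sup>+u. indicator S (\<gamma> (x, u) 1) \<partial>H \<partial>\<mu>)"
      by (rule H.nn_integral_fst[symmetric, OF mi])
    \<comment> \<open>For each fixed \<open>x\<close>, right translation by \<open>x\<close>
      preserves \<open>H\<close>.\<close>
    also have "\<dots> = (\<integral>\<^sup>+x. emeasure H S \<partial>\<mu>)"
    proof (rule nn_integral_cong)
      fix x assume x: "x \<in> space \<mu>"
      then have xS: "x \<in> SO" by (simp add: space)
      have m: "(\<lambda>u. u ** x) \<in> H \<rightarrow>\<^sub>M borel_SO"
        by (auto simp: measurable_borel_SO_iff space intro!: SO_mult xS measurable_from_borel_SO[OF sets(2)])
      have "(\<integral>\<^sup>+u. indicator S (\<gamma> (x, u) 1) \<partial>H) = (\<integral>\<^sup>+u. indicator S (u ** x) \<partial>H)"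
        using x by (intro nn_integral_cong) (simp add: end_points space_pair_measure)
      also have "\<dots> = emeasure (distr H borel_SO (\<lambda>u. u ** x)) S"
        by (intro emeasure_distr_indicator[symmetric] m S)
      also have "distr H borel_SO (\<lambda>u. u ** x) = H"
        using H xS by (simp add: haar_prob_def)
      finally show "(\<integral>\<^sup>+u. indicator S (\<gamma> (x, u) 1) \<partial>H) = emeasure H S" .
    qed
    finally show "emeasure (distr (\<mu> \<Otimes>\<^sub>M H) borel_SO (\<lambda>z. \<gamma> z 1)) S = emeasure H S"
      by (simp add: \<mu>.emeasure_space_1)
  qed (simp add: sets)
  have energy: "energy (B z) = frame_energy ks l (snd z)" if "z \<in> space (\<mu> \<Otimes>\<^sub>M H)" for z
  proof -
    obtain x u where z: "z = (x, u)" "u \<in> SO"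
      using \<open>z \<in> _\<close> by (auto simp: space_pair_measure space)
    have "l \<notin> set ks" using ks(1) by simp
    from norm_frame_velocity[OF this ks(2) z(2)]
    have "(norm (B z s))\<^sup>2 = frame_energy ks l (snd z)" if "s \<in> {0..1}" for s
      using that unfolding B_def z(1) prod.case snd_conv .
    then have "energy (B z) = integral {0..1::real} (\<lambda>s. frame_energy ks l (snd z))"
      unfolding energy_def by (intro integral_cong)
    then show ?thesis by simp
  qed
  have "(\<integral>\<^sup>+z. ennreal (energy (B z)) \<partial>(\<mu> \<Otimes>\<^sub>M H)) = (\<integral>\<^sup>+z. ennreal (frame_energy ks l (snd z)) \<partial>(\<mu> \<Otimes>\<^sub>M H))"
    by (intro nn_integral_cong) (simp add: energy)
  also have "\<dots> = (\<integral>\<^sup>+x. \<integral>\<^sup>+u. ennreal (frame_energy ks l u) \<partial>H \<partial>\<mu>)"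
    by (subst H.nn_integral_fst[symmetric]) auto
  also have "\<dots> = (\<integral>\<^sup>+u. ennreal (frame_energy ks l u) \<partial>H)"
    by (simp add: \<mu>.emeasure_space_1)
  also have "\<dots> \<le> ennreal (pi\<^sup>2 * length ks) * emeasure H SO"
    using H ks by (intro nn_integral_frame_energy sets) (auto simp: haar_prob_def intro!: flip_SO)
  also have "\<dots> \<le> ennreal (pi\<^sup>2 * CARD('n))"
  proof -
    \<comment> \<open>The list has one element less than the dimension; the weaker bound gives the
      constant of the theorem.\<close>
    have "length ks \<le> CARD('n)"
      using ks distinct_card[of ks] by (metis card_mono finite subset_UNIV)
    then show ?thesis
      using H.emeasure_space_1 by (auto simp: space intro!: ennreal_leI mult_left_mono)
  qed
  finally have "(\<integral>\<^sup>+z. ennreal (energy (B z)) \<partial>(\<mu> \<Otimes>\<^sub>M H)) \<le> ennreal (pi\<^sup>2 * CARD('n))" .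
  moreover have "(\<lambda>(z, s). B z s) \<in> borel_measurable ((\<mu> \<Otimes>\<^sub>M H) \<Otimes>\<^sub>M borel)"
    unfolding B_def split_beta by measurable
  ultimately show ?thesis
    unfolding random_curve_def using meas[of 0] meas[of 1]
    by (intro exI[of _ \<gamma>] exI[of _ B] conjI ballI P.prob_space_axioms curve law0 law1) auto
qed

subsection \<open>One step of the walk applied to a curve\<close>

lemma periodic_int_multiple:
  fixes g :: "real \<Rightarrow> 'a"
  assumes "\<And>x. g (x + T) = g x"
  shows "g (x + of_int k * T) = g x"
proof -
  have pos: "g (x + of_nat n * T) = g x" for x n
  proof (induction n)
    case (Suc n)
    have "g (x + of_nat (Suc n) * T) = g ((x + of_nat n * T) + T)" by (simp add: algebra_simps)
    then show ?case using Suc.IH assms by simp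
  qed simp
  show ?thesis
  proof (cases "0 \<le> k")
    case True
    then show ?thesis using pos[of x "nat k"] by simp
  next
    case False
    then show ?thesis using pos[of "x + of_int k * T" "nat (- k)"] by simp
  qed
qed

lemma nn_integral_lborel_shift:
  fixes f :: "real \<Rightarrow> ennreal"
  assumes "f \<in> borel_measurable borel"
  shows "(\<integral>\<^sup>+x. f (x + t) \<partial>lborel) = (\<integral>\<^sup>+x. f x \<partial>lborel)"
  using nn_integral_real_affine[OF assms, of 1 t] by (simp add: add.commute)

text \<open>A uniform angle stays uniform under a shift. The shifted period is cut at a multiple of
  \<open>T\<close>, and the part beyond the cut is moved back by one period. Half-open intervals
  make the pieces fit exactly.\<close>

lemma nn_integral_periodic_shift:
  fixes g :: "real \<Rightarrow> ennreal"
  assumes g [measurable]: "g \<in> borel_measurable borel" and per: "\<And>x. g (x + T) = g x" and T: "0 < T"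
  shows "(\<integral>\<^sup>+x. indicator {0..T} x * g (x - d) \<partial>lborel) = (\<integral>\<^sup>+x. indicator {0..T} x * g x \<partial>lborel)"
proof -
  define F where "F a b = (\<integral>\<^sup>+x. indicator {a..<b} x * g x \<partial>lborel)" for a b
  have shift: "F (a + of_int k * T) (b + of_int k * T) = F a b" for a b k
  proof -
    have "F (a + of_int k * T) (b + of_int k * T) =
        (\<integral>\<^sup>+x. indicator {a + of_int k * T..<b + of_int k * T} (x + of_int k * T) * g (x + of_int k * T) \<partial>lborel)"
      unfolding F_def by (rule nn_integral_lborel_shift[symmetric]) measurable
    also have "\<dots> = F a b"
      unfolding F_def by (intro nn_integral_cong) (auto simp: periodic_int_multiple[of g, OF per] split: split_indicator)
    finally show ?thesis .
  qed
  have split: "F a b + F b c = F a c" if "a \<le> b" "b \<le> c" for a b c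
    unfolding F_def using that
    by (subst nn_integral_add[symmetric]) (auto intro!: nn_integral_cong split: split_indicator)
  have closed: "(\<integral>\<^sup>+x. indicator {0..T} x * h x \<partial>lborel) = (\<integral>\<^sup>+x. indicator {0..<T} x * h x \<partial>lborel)"
    for h :: "real \<Rightarrow> ennreal"
    using AE_lborel_singleton[of T]
    by (intro nn_integral_cong_AE) (auto elim!: eventually_mono split: split_indicator)
  \<comment> \<open>The cut is at (k + 1) T, which lies between -d and -d + T.\<close>
  define k where "k = \<lfloor>- d / T\<rfloor>"
  have "of_int k \<le> - d / T" "- d / T < of_int k + 1"
    unfolding k_def by linarith+
  then have k: "of_int k * T \<le> - d" "- d \<le> of_int k * T + T"
    using T by (simp_all add: field_simps)
  have "(\<integral>\<^sup>+x. indicator {0..<T} x * g (x - d) \<partial>lborel)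
      = (\<integral>\<^sup>+x. indicator {0..<T} (x + d) * g (x + d - d) \<partial>lborel)"
    by (rule nn_integral_lborel_shift[symmetric]) measurable
  also have "\<dots> = F (- d) (- d + T)"
    unfolding F_def by (intro nn_integral_cong) (auto split: split_indicator)
  also have "\<dots> = F (- d) (of_int k * T + T) + F (of_int k * T + T) (- d + T)"
    using k by (intro split[symmetric]) auto
  also have "F (of_int k * T + T) (- d + T) = F (of_int k * T) (- d)"
    using shift[of "of_int k * T" 1 "- d"] by simp
  also have "F (- d) (of_int k * T + T) + F (of_int k * T) (- d) = F (of_int k * T) (of_int k * T + T)"
    using split[of "of_int k * T" "- d" "of_int k * T + T"] k by (simp add: add.commute)
  also have "\<dots> = F 0 T"
    using shift[of 0 k T] by (simp add: add.commute)
  finally show ?thesis by (simp add: closed F_def)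
qed

section \<open>Sums over coordinate planes\<close>

lemma sum_symmetric_pairs:
  fixes h :: "'n::{finite,linorder} \<Rightarrow> 'n \<Rightarrow> real"
  assumes "\<And>i j. h i j = h j i" "\<And>i. h i i = 0"
  shows "(\<Sum>i\<in>UNIV. \<Sum>j\<in>UNIV. h i j) = 2 * (\<Sum>(i, j)\<in>{(i, j). i < j}. h i j)"
proof -
  have "(\<Sum>i\<in>UNIV. \<Sum>j\<in>UNIV. h i j) = (\<Sum>(i, j)\<in>UNIV. h i j)"
    by (simp add: sum.cartesian_product)
  also have "UNIV = {(i, j). i < j} \<union> {(i::'n, j). j < i} \<union> {(i, j). i = j}"
    by auto
  also have "(\<Sum>(i, j)\<in>\<dots>. h i j) = (\<Sum>(i, j)\<in>{(i, j). i < j}. h i j)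
      + (\<Sum>(i, j)\<in>{(i, j). j < i}. h i j) + (\<Sum>(i, j)\<in>{(i, j). i = j}. h i j)"
    by (subst sum.union_disjoint, auto)+
  also have "(\<Sum>(i, j)\<in>{(i, j). i = j}. h i j) = 0"
    using assms(2) by (intro sum.neutral) auto
  also have "(\<Sum>(i, j)\<in>{(i, j). j < i}. h i j) = (\<Sum>(i, j)\<in>{(i, j). i < j}. h i j)"
    using assms(1) by (intro sum.reindex_bij_witness[of _ prod.swap prod.swap]) auto
  finally show ?thesis by simp
qed

lemma card_ordered_pairs: "real (card {(i, j). i < (j::'n::{finite,linorder})}) = real (CARD('n) choose 2)"
proof -
  \<comment> \<open>Pairs are counted as the symmetric function that is 1 off the diagonal and 0 on
    it.\<close>
  have "2 * (\<Sum>(i, j)\<in>{(i, j). i < (j::'n)}. (if i = j then 0 else 1::real)) = (\<Sum>i\<in>(UNIV::'n set). \<Sum>j\<in>(UNIV::'n set). if i = j then 0 else 1)"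
    by (rule sum_symmetric_pairs[symmetric]) auto
  also have "\<dots> = (\<Sum>i\<in>(UNIV::'n set). real (CARD('n)) - 1)"
  proof (rule sum.cong[OF refl])
    fix i :: 'n
    have "(\<Sum>j\<in>(UNIV::'n set). if i = j then 0 else 1::real) = (\<Sum>j\<in>UNIV. 1 - (if i = j then 1 else 0))"
      by (intro sum.cong) auto
    then show "(\<Sum>j\<in>(UNIV::'n set). if i = j then 0 else 1::real) = real (CARD('n)) - 1"
      by (simp add: sum_subtractf)
  qed
  also have "(\<Sum>(i, j)\<in>{(i, j). i < (j::'n)}. (if i = j then 0 else 1::real)) = (\<Sum>p\<in>{(i, j). i < (j::'n)}. 1)"
    by (intro sum.cong) auto
  finally have "2 * real (card {(i, j). i < (j::'n)}) = CARD('n) * (real CARD('n) - 1)"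
    by simp
  moreover have "2 * real (CARD('n) choose 2) = CARD('n) * (real CARD('n) - 1)"
    by (simp add: choose_two real_of_nat_div of_nat_diff Suc_leI)
  ultimately show ?thesis by simp
qed

lemma sum_over_steps:
  fixes g :: "bool \<times> 'n \<times> 'n::{finite,linorder} \<Rightarrow> 'b::comm_monoid_add"
  assumes "\<And>b i j. \<not> i < j \<Longrightarrow> g (b, i, j) = 0"
  shows "(\<Sum>p\<in>UNIV. g p) = (\<Sum>(i, j)\<in>{(i, j). i < j}. g (True, i, j) + g (False, i, j))"
proof -
  have "(\<Sum>p\<in>UNIV. g p) = (\<Sum>b\<in>UNIV. \<Sum>q\<in>UNIV. g (b, q))"
    by (simp add: sum.cartesian_product)
  also have "\<dots> = (\<Sum>q\<in>UNIV. g (True, q) + g (False, q))"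
    by (simp add: UNIV_bool sum.distrib add.commute)
  also have "\<dots> = (\<Sum>q\<in>{(i, j). i < j}. g (True, q) + g (False, q))"
  proof (rule sum.mono_neutral_right)
    show "\<forall>q\<in>UNIV - {(i, j). i < j}. g (True, q) + g (False, q) = 0"
    proof
      fix q :: "'n \<times> 'n"
      assume "q \<in> UNIV - {(i, j). i < j}"
      then have "\<not> fst q < snd q" by auto
      then show "g (True, q) + g (False, q) = 0"
        using assms[of "fst q" "snd q"] by simp
    qed
  qed simp_all
  finally show ?thesis by (simp add: case_prod_unfold)
qed

section \<open>Compensated turns of a curve\<close>

text \<open>A Lebesgue integral over the whole line with the cut-off in the integrand, so that
  measurability in \<open>s\<close> and in further parameters of \<open>f\<close> is
  immediate.\<close>

definition primitive :: "(real \<Rightarrow> real) \<Rightarrow> real \<Rightarrow> real" where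
  "primitive f s = (LINT r|lborel. (if 0 \<le> r \<and> r \<le> s then f r else 0))"

lemma primitive_has_derivative:
  assumes f: "continuous_on {0..1} f" and t: "t \<in> {0..1}"
  shows "(primitive f has_vector_derivative f t) (at t within {0..1})"
proof -
  have eq: "primitive f u = integral {0..u} f" if "u \<in> {0..1}" for u
  proof -
    have "continuous_on {0..u} f" using that by (intro continuous_on_subset[OF f]) auto
    then have "set_integrable lborel {0..u} f"
      unfolding set_integrable_def by (intro borel_integrable_compact) simp
    from set_borel_integral_eq_integral(2)[OF this]
    have "integral {0..u} f = (LINT r|lborel. indicator {0..u} r *\<^sub>R f r)"
      by (simp add: set_lebesgue_integral_def)
    also have "\<dots> = primitive f u"
      unfolding primitive_def by (intro Bochner_Integration.integral_cong) (auto simp: indicator_def)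
    finally show ?thesis by simp
  qed
  show ?thesis
    by (rule has_vector_derivative_transform[OF t eq integral_has_vector_derivative[OF f t]])
qed

text \<open>The Boolean tells whether the angle comes from the uniform part of the density
  (\<open>True\<close>) or from the rest. Pairs without \<open>i < j\<close> belong to the type but
  will carry weight 0.\<close>

type_synonym 'n step = "bool \<times> 'n \<times> 'n"

text \<open>The shift \<open>d\<close> acts on the uniform part only; along a curve it will be the
  value of \<open>phase\<close>.\<close>

definition turn :: "'n::{finite,linorder} step \<Rightarrow> real \<Rightarrow> real \<Rightarrow> real^'n::_^'n::_" where
  "turn = (\<lambda>(b, i, j) d \<theta>. if i < j then rot i j (\<theta> - (if b then d else 0)) else mat 1)"

definition phase :: "'n::finite step \<Rightarrow> (real \<Rightarrow> real^'n::_^'n::_) \<Rightarrow> real \<Rightarrow> real" where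
  "phase = (\<lambda>(b, i, j) C. primitive (\<lambda>r. C r $ j $ i))"

text \<open>The angular speed is the negative of the entry that \<open>phase\<close> integrates,
  chosen to cancel this component of the velocity.\<close>

definition turn_velocity :: "'n::{finite,linorder} step \<Rightarrow> (real \<Rightarrow> real^'n::_^'n::_) \<Rightarrow> real \<Rightarrow> real^'n::_^'n::_" where
  "turn_velocity = (\<lambda>(b, i, j) C s.
     if i < j then (if b then - (C s $ j $ i) else 0) *\<^sub>R plane_gen (axis i 1) (axis j 1) else 0)"

definition entry_energy :: "'n \<Rightarrow> 'n \<Rightarrow> (real \<Rightarrow> real^'n^'n) \<Rightarrow> real" where
  "entry_energy i j C = integral {0..1} (\<lambda>s. (C s $ j $ i)\<^sup>2)"

lemma smooth_entry: "smooth C \<Longrightarrow> smooth (\<lambda>s. (C s :: real^'n^'n) $ j $ i)"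
  by (intro smooth_linear[OF bounded_linear_vec_nth])

lemma SO_curve_turn:
  fixes p :: "'n::{finite,linorder} step"
  assumes C: "smooth C"
  shows "SO_curve (\<lambda>s. turn p (phase p C s) \<theta>) (turn_velocity p C)"
proof -
  obtain b i j where p: "p = (b, i, j)" by (cases p)
  show ?thesis
  proof (cases "i < j")
    case True
    then have ij: "i \<noteq> j" by auto
    have "((\<lambda>s. \<theta> - (if b then phase (b, i, j) C s else 0)) has_vector_derivative (if b then - (C t $ j $ i) else 0))
        (at t within {0..1})" if t: "t \<in> {0..1}" for t
    proof (cases b)
      case True
      then show ?thesis
        using has_vector_derivative_diff[OF has_vector_derivative_const
          primitive_has_derivative[OF smooth_continuous_on[OF smooth_entry[OF C]] t], of \<theta> j i]
        by (simp add: phase_def)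
    qed simp
    moreover have "smooth (\<lambda>t. if b then - (C t $ j $ i) else 0)"
      using smooth_linear[OF bounded_linear_minus[OF bounded_linear_ident] smooth_entry[OF C, of j i]]
      by (cases b) (auto simp: smooth_const)
    ultimately show ?thesis
      using SO_curve_plane_rot[OF orthonormal_pair_axis[OF ij], of "\<lambda>t. if b then - (C t $ j $ i) else 0"
          "\<lambda>s. \<theta> - (if b then phase (b, i, j) C s else 0)"] True
      by (simp add: p turn_def turn_velocity_def rot_eq_plane_rot[OF ij])
  next
    case False
    then show ?thesis
      using SO_curve_const[OF mat_1_SO] by (simp add: p turn_def turn_velocity_def)
  qed
qed

definition step_velocity :: "'n::{finite,linorder} step \<Rightarrow> real \<Rightarrow> (real \<Rightarrow> real^'n::_^'n::_) \<Rightarrow> real \<Rightarrow> real^'n::_^'n::_" where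
  "step_velocity p \<theta> C s = turn_velocity p C s +
     turn p (phase p C s) \<theta> ** C s ** transpose (turn p (phase p C s) \<theta>)"

lemma SO_curve_step:
  fixes p :: "'n::{finite,linorder} step"
  assumes "SO_curve \<gamma> C"
  shows "SO_curve (\<lambda>s. turn p (phase p C s) \<theta> ** \<gamma> s) (step_velocity p \<theta> C)"
proof -
  have "smooth C" using assms by (simp add: SO_curve_def)
  from SO_curve_mult[OF SO_curve_turn[OF this] assms]
  show ?thesis unfolding step_velocity_def[abs_def] .
qed

text \<open>On the uniform part the coefficient of the generator is the minimiser in
  \<open>norm_plane_gen_add_conj\<close>; otherwise the velocity is merely conjugated. The result
  does not depend on \<open>\<theta>\<close>.\<close>

lemma energy_step:
  fixes b :: bool and i j :: "'n::{finite,linorder}"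
  assumes "SO_curve \<gamma> C" and "i < j"
  shows "energy (step_velocity (b, i, j) \<theta> C) = energy C - (if b then 2 * entry_energy i j C else 0)"
proof -
  have ij: "i \<noteq> j" using assms by auto
  have C: "continuous_on {0..1} C"
    using assms by (auto simp: SO_curve_def intro: smooth_continuous_on)
  have "(norm (step_velocity (b, i, j) \<theta> C s))\<^sup>2 = (norm (C s))\<^sup>2 - (if b then 2 * (C s $ j $ i)\<^sup>2 else 0)"
    if s: "s \<in> {0..1}" for s
  proof -
    have "transpose (C s) = - C s" using assms s by (simp add: SO_curve_def)
    from norm_plane_gen_add_conj[OF orthonormal_pair_axis[OF ij] this refl]
    show ?thesis
      using assms(2)
      by (simp add: step_velocity_def turn_velocity_def turn_def rot_eq_plane_rot[OF ij] axis_inner mult_vec_nth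
          power2_eq_square)
  qed
  then have "energy (step_velocity (b, i, j) \<theta> C) =
      integral {0..1} (\<lambda>s. (norm (C s))\<^sup>2 - (if b then 2 * (C s $ j $ i)\<^sup>2 else 0))"
    unfolding energy_def by (intro integral_cong)
  also have "\<dots> = energy C - (if b then 2 * entry_energy i j C else 0)"
  proof (cases b)
    case True
    have "(\<lambda>s. (C s $ j $ i)\<^sup>2) integrable_on {0..1}" "(\<lambda>s. (norm (C s))\<^sup>2) integrable_on {0..1}"
      using C by (auto intro!: integrable_continuous_real continuous_intros)
    then show ?thesis
      using True by (simp add: energy_def entry_energy_def integral_diff integrable_on_cmult_left)
  qed (simp add: energy_def)
  finally show ?thesis .
qed

text \<open>The squared norm of a skew matrix is twice the sum of squares on one side of the
  diagonal. So the losses in the various planes together exhaust the energy.\<close>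

lemma sum_entry_energy:
  fixes C :: "real \<Rightarrow> real^'n::{finite,linorder}^'n::_"
  assumes "SO_curve \<gamma> C"
  shows "(\<Sum>(i, j)\<in>{(i, j). i < j}. 2 * entry_energy i j C) = energy C"
proof -
  have C: "continuous_on {0..1} C"
    using assms by (auto simp: SO_curve_def intro: smooth_continuous_on)
  have int: "(\<lambda>s. 2 * (C s $ j $ i)\<^sup>2) integrable_on {0..1}" for i j
    using C by (auto intro!: integrable_continuous_real continuous_intros)
  have "(norm (C s))\<^sup>2 = (\<Sum>(i, j)\<in>{(i, j). i < j}. 2 * (C s $ j $ i)\<^sup>2)" if s: "s \<in> {0..1}" for s
  proof -
    have skew: "C s $ i $ j = - (C s $ j $ i)" for i j
    proof -
      have "transpose (C s) = - C s" using assms s by (simp add: SO_curve_def)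
      then have "transpose (C s) $ j $ i = (- C s) $ j $ i" by (simp only:)
      then show ?thesis by (simp add: transpose_def)
    qed
    have "(norm (C s))\<^sup>2 = (\<Sum>i\<in>UNIV. \<Sum>j\<in>UNIV. (C s $ j $ i)\<^sup>2)"
      unfolding power2_norm_eq_inner by (subst sum.swap) (simp add: inner_vec_def power2_eq_square)
    also have "\<dots> = 2 * (\<Sum>(i, j)\<in>{(i, j). i < j}. (C s $ j $ i)\<^sup>2)"
    proof (rule sum_symmetric_pairs)
      fix i j
      show "(C s $ j $ i)\<^sup>2 = (C s $ i $ j)\<^sup>2"
        unfolding skew[of j i] by (rule power2_minus)
      have "C s $ i $ i = 0" using skew[of i i] by linarith
      then show "(C s $ i $ i)\<^sup>2 = 0" by simp
    qed
    also have "\<dots> = (\<Sum>(i, j)\<in>{(i, j). i < j}. 2 * (C s $ j $ i)\<^sup>2)"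
      by (simp add: sum_distrib_left case_prod_unfold)
    finally show ?thesis .
  qed
  then have "energy C = integral {0..1} (\<lambda>s. \<Sum>(i, j)\<in>{(i, j). i < j}. 2 * (C s $ j $ i)\<^sup>2)"
    unfolding energy_def by (intro integral_cong)
  also have "\<dots> = (\<Sum>(i, j)\<in>{(i, j). i < j}. integral {0..1} (\<lambda>s. 2 * (C s $ j $ i)\<^sup>2))"
    unfolding case_prod_unfold by (intro integral_sum int) simp
  finally show ?thesis by (simp add: entry_energy_def)
qed

subsection \<open>The walk\<close>

locale kac_walk =
  fixes \<rho> :: "real \<Rightarrow> real" and \<rho>min :: real
    and H :: "(real^'n::{finite,linorder}^'n::_) measure"
  assumes card_ge_2: "2 \<le> CARD('n)"
    and density: "prob_density_2pi \<rho>"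
    and lower: "\<And>\<theta>. \<theta> \<in> {0..2*pi} \<Longrightarrow> \<rho>min \<le> \<rho> \<theta>"
    and pos: "0 < \<rho>min"
    and haar: "haar_prob H"
begin

section \<open>The law of a single step\<close>

definition num_planes :: real where
  "num_planes = real (CARD('n) choose 2)"

lemma num_planes_pos: "0 < num_planes"
  using card_ge_2 by (simp add: num_planes_def zero_less_binomial)

text \<open>The plane is uniform, and \<open>\<rho>\<close> is split into the constant
  \<open>\<rho>min\<close> and the nonnegative rest.\<close>

definition weight :: "'n step \<Rightarrow> real \<Rightarrow> real" where
  "weight = (\<lambda>(b, i, j) \<theta>. if i < j then
     indicator {0..2*pi} \<theta> * (if b then \<rho>min else \<rho> \<theta> - \<rho>min) * (1 / num_planes) else 0)"

definition steps :: "('n step \<times> real) measure" where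
  "steps = density (count_space UNIV \<Otimes>\<^sub>M lborel) (\<lambda>(p, \<theta>). ennreal (weight p \<theta>))"

lemma weight_nonneg: "0 \<le> weight p \<theta>"
  using lower pos num_planes_pos by (cases p) (auto simp: weight_def indicator_def)

lemma integrable_density: "integrable lborel (\<lambda>\<theta>. indicator {0..2*pi} \<theta> * \<rho> \<theta>)"
  and integral_density: "(LINT \<theta>|lborel. indicator {0..2*pi} \<theta> * \<rho> \<theta>) = 1"
  using density by (simp_all add: prob_density_2pi_def set_integrable_def set_lebesgue_integral_def)

lemma borel_measurable_density [measurable]: "(\<lambda>\<theta>. indicator {0..2*pi} \<theta> * \<rho> \<theta>) \<in> borel_measurable borel"
  using borel_measurable_integrable[OF integrable_density] by simp

text \<open>The density is known to be measurable on \<open>{0..2*pi}\<close> only, so it is brought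
  together with the indicator of this interval.\<close>

lemma weight_eq: "weight (b, i, j) = (\<lambda>\<theta>. if i < j then
    (if b then \<rho>min * indicator {0..2*pi} \<theta> else indicator {0..2*pi} \<theta> * \<rho> \<theta> - \<rho>min * indicator {0..2*pi} \<theta>)
     * (1 / num_planes) else 0)"
  by (auto simp: weight_def fun_eq_iff indicator_def)

lemma borel_measurable_weight [measurable]: "weight p \<in> borel_measurable borel"
proof -
  obtain b i j where "p = (b, i, j)" by (cases p)
  then show ?thesis by (simp add: weight_eq)
qed

lemma borel_measurable_weight_pair [measurable]:
  "(\<lambda>(p, \<theta>). ennreal (weight p \<theta>)) \<in> borel_measurable (count_space UNIV \<Otimes>\<^sub>M lborel)"
  by (intro measurable_pair_measure_countable1) auto

lemma sets_steps [measurable_cong]: "sets steps = sets (count_space UNIV \<Otimes>\<^sub>M borel)"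
proof -
  have "sets steps = sets (count_space UNIV \<Otimes>\<^sub>M lborel)" by (simp add: steps_def)
  also have "\<dots> = sets (count_space UNIV \<Otimes>\<^sub>M borel)" by (intro sets_pair_measure_cong) simp_all
  finally show ?thesis .
qed

lemma nn_integral_steps:
  assumes f: "f \<in> borel_measurable (count_space UNIV \<Otimes>\<^sub>M borel)"
  shows "(\<integral>\<^sup>+q. f q \<partial>steps) = (\<Sum>p\<in>UNIV. \<integral>\<^sup>+\<theta>. ennreal (weight p \<theta>) * f (p, \<theta>) \<partial>lborel)"
proof -
  have [measurable]: "f \<in> borel_measurable (count_space UNIV \<Otimes>\<^sub>M lborel)"
    using f by (simp cong: measurable_cong_sets sets_pair_measure_cong)
  have "(\<integral>\<^sup>+q. f q \<partial>steps) = (\<integral>\<^sup>+q. ennreal (weight (fst q) (snd q)) * f q \<partial>(count_space UNIV \<Otimes>\<^sub>M lborel))"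
    unfolding steps_def by (subst nn_integral_density) (simp_all add: case_prod_unfold)
  also have "\<dots> = (\<integral>\<^sup>+p. \<integral>\<^sup>+\<theta>. ennreal (weight p \<theta>) * f (p, \<theta>) \<partial>lborel \<partial>count_space UNIV)"
    using borel_measurable_weight_pair
    by (subst lborel.nn_integral_fst[symmetric]) (simp_all add: case_prod_unfold)
  finally show ?thesis by (simp add: nn_integral_count_space_finite)
qed

text \<open>Each plane is compensated with probability
  \<open>2 * pi * \<rho>min / num_planes\<close>, and the energies lost in the single planes add up
  to the whole.\<close>

definition contraction :: real where
  "contraction = 1 - 2 * pi * \<rho>min / num_planes"

lemma nn_integral_weight:
  assumes "i < j"
  shows "(\<integral>\<^sup>+\<theta>. ennreal (weight (b, i, j) \<theta>) \<partial>lborel)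
    = ennreal ((if b then 2 * pi * \<rho>min else 1 - 2 * pi * \<rho>min) / num_planes)"
    and "0 \<le> (if b then 2 * pi * \<rho>min else 1 - 2 * pi * \<rho>min) / num_planes"
proof -
  have c: "integrable lborel (\<lambda>\<theta>. \<rho>min * indicator {0..2*pi} \<theta>)"
    "(LINT \<theta>|lborel. \<rho>min * indicator {0..2*pi} \<theta>) = 2 * pi * \<rho>min"
    by simp_all
  have int: "integrable lborel (weight (b, i, j))"
    unfolding weight_eq using c(1) integrable_density assms by (cases b) simp_all
  have val: "(LINT \<theta>|lborel. weight (b, i, j) \<theta>) = (if b then 2 * pi * \<rho>min else 1 - 2 * pi * \<rho>min) / num_planes"
    unfolding weight_eq using c integrable_density integral_density assms by (cases b) simp_all
  show "(\<integral>\<^sup>+\<theta>. ennreal (weight (b, i, j) \<theta>) \<partial>lborel)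
    = ennreal ((if b then 2 * pi * \<rho>min else 1 - 2 * pi * \<rho>min) / num_planes)"
    using nn_integral_eq_integral[OF int] weight_nonneg val by simp
  show "0 \<le> (if b then 2 * pi * \<rho>min else 1 - 2 * pi * \<rho>min) / num_planes"
    \<comment> \<open>As integrals of nonnegative weights these masses are nonnegative; for
      \<open>b = False\<close> this yields \<open>2 * pi * \<rho>min \<le> 1\<close>.\<close>
    unfolding val[symmetric] by (intro integral_nonneg_AE) (simp add: weight_nonneg)
qed

lemma weight_zero: "\<not> i < j \<Longrightarrow> weight (b, i, j) \<theta> = 0"
  by (simp add: weight_def)

lemma nn_integral_steps_fst:
  fixes g :: "'n step \<Rightarrow> real"
  assumes "\<And>p. 0 \<le> g p"
  shows "(\<integral>\<^sup>+q. ennreal (g (fst q)) \<partial>steps) = ennreal (\<Sum>(i, j)\<in>{(i, j). i < j}.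
     (2 * pi * \<rho>min * g (True, i, j) + (1 - 2 * pi * \<rho>min) * g (False, i, j)) / num_planes)"
proof -
  have m: "(\<lambda>q. ennreal (g (fst q))) \<in> borel_measurable (count_space UNIV \<Otimes>\<^sub>M borel)"
    by (rule measurable_compose[OF measurable_fst]) simp
  have "(\<integral>\<^sup>+q. ennreal (g (fst q)) \<partial>steps) = (\<Sum>p\<in>UNIV. (\<integral>\<^sup>+\<theta>. ennreal (weight p \<theta>) \<partial>lborel) * ennreal (g p))"
    by (simp add: nn_integral_steps[OF m] nn_integral_multc)
  also have "\<dots> = (\<Sum>(i, j)\<in>{(i, j). i < j}.
      (\<integral>\<^sup>+\<theta>. ennreal (weight (True, i, j) \<theta>) \<partial>lborel) * ennreal (g (True, i, j)) +
      (\<integral>\<^sup>+\<theta>. ennreal (weight (False, i, j) \<theta>) \<partial>lborel) * ennreal (g (False, i, j)))"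
    by (rule sum_over_steps) (simp add: weight_zero)
  also have "\<dots> = (\<Sum>(i, j)\<in>{(i, j). i < j}.
     ennreal ((2 * pi * \<rho>min * g (True, i, j) + (1 - 2 * pi * \<rho>min) * g (False, i, j)) / num_planes))"
  proof (intro sum.cong refl, clarify)
    fix i j :: 'n
    assume ij: "i < j"
    show "(\<integral>\<^sup>+\<theta>. ennreal (weight (True, i, j) \<theta>) \<partial>lborel) * ennreal (g (True, i, j)) +
      (\<integral>\<^sup>+\<theta>. ennreal (weight (False, i, j) \<theta>) \<partial>lborel) * ennreal (g (False, i, j)) =
      ennreal ((2 * pi * \<rho>min * g (True, i, j) + (1 - 2 * pi * \<rho>min) * g (False, i, j)) / num_planes)"
      using nn_integral_weight[OF ij, of True] nn_integral_weight[OF ij, of False] assms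
      by (simp add: ennreal_mult[symmetric] ennreal_plus[symmetric] add_divide_distrib
          times_divide_eq_left[symmetric] del: ennreal_plus times_divide_eq_left)
  qed
  also have "\<dots> = ennreal (\<Sum>(i, j)\<in>{(i, j). i < j}.
     (2 * pi * \<rho>min * g (True, i, j) + (1 - 2 * pi * \<rho>min) * g (False, i, j)) / num_planes)"
    unfolding case_prod_unfold
  proof (rule sum_ennreal)
    fix q :: "'n \<times> 'n"
    assume "q \<in> {q. fst q < snd q}"
    then have "fst q < snd q" by simp
    from nn_integral_weight(2)[OF this, of True] nn_integral_weight(2)[OF this, of False] num_planes_pos
    have "0 \<le> 2 * pi * \<rho>min" "0 \<le> 1 - 2 * pi * \<rho>min"
      by (simp_all add: zero_le_divide_iff)
    then show "0 \<le> (2 * pi * \<rho>min * g (True, fst q, snd q) + (1 - 2 * pi * \<rho>min) * g (False, fst q, snd q)) / num_planes"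
      using assms num_planes_pos pos by (intro divide_nonneg_pos add_nonneg_nonneg mult_nonneg_nonneg) auto
  qed
  finally show ?thesis .
qed

lemma sum_const_pairs: "(\<Sum>(i, j)\<in>{(i, j). i < (j::'n)}. c / num_planes) = c"
  using num_planes_pos by (simp add: case_prod_unfold card_ordered_pairs[unfolded case_prod_unfold] num_planes_def)

lemma prob_space_steps: "prob_space steps"
proof
  have "emeasure steps (space steps) = (\<integral>\<^sup>+q. ennreal 1 \<partial>steps)" by simp
  also have "\<dots> = ennreal (\<Sum>(i, j)\<in>{(i, j). i < (j::'n)}. (2 * pi * \<rho>min * 1 + (1 - 2 * pi * \<rho>min) * 1) / num_planes)"
    by (rule nn_integral_steps_fst) simp
  also have "\<dots> = 1"
    unfolding sum_const_pairs by simp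
  finally show "emeasure steps (space steps) = 1" .
qed

section \<open>The kernel as the law of a random turn\<close>

lemma borel_measurable_turn [measurable (raw)]:
  fixes d \<theta> :: "'a \<Rightarrow> real"
  assumes [measurable]: "d \<in> borel_measurable M" "\<theta> \<in> borel_measurable M"
  shows "(\<lambda>x. turn (p :: 'n step) (d x) (\<theta> x)) \<in> borel_measurable M"
proof -
  obtain b i j where p: "p = (b, i, j)" by (cases p)
  show ?thesis
  proof (cases "i < j")
    case True
    then have "i \<noteq> j" by auto
    then show ?thesis by (simp add: p turn_def True rot_eq_plane_rot)
  qed (simp add: p turn_def)
qed

lemma turn_SO: "turn (p :: 'n step) d \<theta> \<in> SO"
proof -
  obtain b i j where p: "p = (b, i, j)" by (cases p)
  show ?thesis
  proof (cases "i < j")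
    case True
    then have "i \<noteq> j" by auto
    then show ?thesis by (simp add: p turn_def True rot_eq_plane_rot plane_rot_SO orthonormal_pair_axis)
  qed (simp add: p turn_def)
qed

text \<open>A shift of the angle that depends on the plane only is invisible on the part of the step
  law with constant weight.\<close>

lemma kac_kernel_eq_steps:
  assumes y: "y \<in> SO" and S [measurable]: "S \<in> sets borel_SO"
  shows "(\<integral>\<^sup>+(p, \<theta>). indicator S (turn p (d p) \<theta> ** y) \<partial>steps) = emeasure (kac_kernel \<rho> y) S"
proof -
  have S_borel [measurable]: "S \<in> sets borel" by (rule borel_SO_sets_borel[OF S])
  have m: "(\<lambda>(p, \<theta>). indicator S (turn p (d p) \<theta> ** y) :: ennreal) \<in> borel_measurable (count_space UNIV \<Otimes>\<^sub>M borel)"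
    by (intro measurable_pair_measure_countable1) auto
  define g where "g i j \<theta> = (indicator S (rot i j \<theta> ** y) :: ennreal)" for i j \<theta>
  have g [measurable]: "g i j \<in> borel_measurable borel" if "i < j" for i j
    using that by (auto simp: g_def[abs_def] rot_eq_plane_rot)
  let ?c = "ennreal (1 / num_planes)"
  have "(\<integral>\<^sup>+(p, \<theta>). indicator S (turn p (d p) \<theta> ** y) \<partial>steps) =
      (\<Sum>p\<in>UNIV. \<integral>\<^sup>+\<theta>. ennreal (weight p \<theta>) * indicator S (turn p (d p) \<theta> ** y) \<partial>lborel)"
    by (simp add: nn_integral_steps[OF m])
  also have "\<dots> = (\<Sum>(i, j)\<in>{(i, j). i < j}.
      (\<integral>\<^sup>+\<theta>. ennreal (weight (True, i, j) \<theta>) * indicator S (turn (True, i, j) (d (True, i, j)) \<theta> ** y) \<partial>lborel) +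
      (\<integral>\<^sup>+\<theta>. ennreal (weight (False, i, j) \<theta>) * indicator S (turn (False, i, j) (d (False, i, j)) \<theta> ** y) \<partial>lborel))"
    by (rule sum_over_steps) (simp add: weight_zero)
  also have "\<dots> = (\<Sum>(i, j)\<in>{(i, j). i < j}.
      (\<integral>\<^sup>+\<theta>\<in>{0..2*pi}. indicator S (rot i j \<theta> ** y) * ennreal (\<rho> \<theta>) \<partial>lborel) * ?c)"
  proof (intro sum.cong refl, clarify)
    fix i j :: 'n
    assume ij: "i < j"
    note [measurable] = g[OF ij]
    \<comment> \<open>The angle interval is exactly one period of the rotation.\<close>
    have per: "g i j (\<theta> + 2 * pi) = g i j \<theta>" for \<theta>
      unfolding g_def rot_def sin_periodic cos_periodic ..
    have "(\<integral>\<^sup>+\<theta>. ennreal (weight (True, i, j) \<theta>) * indicator S (turn (True, i, j) (d (True, i, j)) \<theta> ** y) \<partial>lborel)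
        = (\<integral>\<^sup>+\<theta>. ennreal (\<rho>min / num_planes) * (indicator {0..2*pi} \<theta> * g i j (\<theta> - d (True, i, j))) \<partial>lborel)"
      using ij by (intro nn_integral_cong) (auto simp: weight_def turn_def g_def split: split_indicator)
    also have "\<dots> = (\<integral>\<^sup>+\<theta>. ennreal (\<rho>min / num_planes) * (indicator {0..2*pi} \<theta> * g i j \<theta>) \<partial>lborel)"
      by (simp add: nn_integral_cmult nn_integral_periodic_shift[OF g[OF ij] per])
    finally have "(\<integral>\<^sup>+\<theta>. ennreal (weight (True, i, j) \<theta>) * indicator S (turn (True, i, j) (d (True, i, j)) \<theta> ** y) \<partial>lborel) +
        (\<integral>\<^sup>+\<theta>. ennreal (weight (False, i, j) \<theta>) * indicator S (turn (False, i, j) (d (False, i, j)) \<theta> ** y) \<partial>lborel) =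
        (\<integral>\<^sup>+\<theta>. ennreal (\<rho>min / num_planes) * (indicator {0..2*pi} \<theta> * g i j \<theta>) \<partial>lborel) +
        (\<integral>\<^sup>+\<theta>. ennreal (weight (False, i, j) \<theta>) * g i j \<theta> \<partial>lborel)"
      using ij by (simp add: turn_def g_def)
    also have "\<dots> = (\<integral>\<^sup>+\<theta>. ennreal (\<rho>min / num_planes) * (indicator {0..2*pi} \<theta> * g i j \<theta>)
        + ennreal (weight (False, i, j) \<theta>) * g i j \<theta> \<partial>lborel)"
      by (rule nn_integral_add[symmetric]) auto
    also have "\<dots> = (\<integral>\<^sup>+\<theta>. (ennreal (indicator {0..2*pi} \<theta> * \<rho> \<theta>) * g i j \<theta>) * ?c \<partial>lborel)"
    proof (rule nn_integral_cong)
      fix \<theta> :: real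
      show "ennreal (\<rho>min / num_planes) * (indicator {0..2*pi} \<theta> * g i j \<theta>) + ennreal (weight (False, i, j) \<theta>) * g i j \<theta>
          = (ennreal (indicator {0..2*pi} \<theta> * \<rho> \<theta>) * g i j \<theta>) * ?c"
      proof (cases "\<theta> \<in> {0..2*pi}")
        case True
        \<comment> \<open>The two parts of the density recombine to \<open>\<rho>\<close>.\<close>
        have "ennreal (\<rho>min / num_planes) + ennreal ((\<rho> \<theta> - \<rho>min) / num_planes) = ennreal (\<rho> \<theta> / num_planes)"
          using lower[OF True] pos num_planes_pos
          by (simp add: ennreal_plus[symmetric] diff_divide_distrib[symmetric] add_divide_distrib[symmetric] del: ennreal_plus)
        also have "\<dots> = ennreal (\<rho> \<theta>) * ?c"
          using lower[OF True] pos num_planes_pos by (simp add: ennreal_mult[symmetric])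
        finally have "ennreal (\<rho>min / num_planes) * g i j \<theta> + ennreal ((\<rho> \<theta> - \<rho>min) / num_planes) * g i j \<theta>
            = ennreal (\<rho> \<theta>) * ?c * g i j \<theta>" by (simp only: distrib_right[symmetric])
        then show ?thesis
          using True ij by (simp add: weight_def mult_ac)
      next
        case False
        then show ?thesis using ij by (simp add: weight_def)
      qed
    qed
    also have "\<dots> = (\<integral>\<^sup>+\<theta>. ennreal (indicator {0..2*pi} \<theta> * \<rho> \<theta>) * g i j \<theta> \<partial>lborel) * ?c"
      by (rule nn_integral_multc) auto
    also have "(\<integral>\<^sup>+\<theta>. ennreal (indicator {0..2*pi} \<theta> * \<rho> \<theta>) * g i j \<theta> \<partial>lborel) =
        (\<integral>\<^sup>+\<theta>\<in>{0..2*pi}. indicator S (rot i j \<theta> ** y) * ennreal (\<rho> \<theta>) \<partial>lborel)"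
      by (intro nn_integral_cong) (auto simp: g_def split: split_indicator)
    finally show "(\<integral>\<^sup>+\<theta>. ennreal (weight (True, i, j) \<theta>) * indicator S (turn (True, i, j) (d (True, i, j)) \<theta> ** y) \<partial>lborel) +
        (\<integral>\<^sup>+\<theta>. ennreal (weight (False, i, j) \<theta>) * indicator S (turn (False, i, j) (d (False, i, j)) \<theta> ** y) \<partial>lborel) =
        (\<integral>\<^sup>+\<theta>\<in>{0..2*pi}. indicator S (rot i j \<theta> ** y) * ennreal (\<rho> \<theta>) \<partial>lborel) * ?c" .
  qed
  also have "\<dots> = (\<Sum>(i, j)\<in>{(i, j). i < j}.
      \<integral>\<^sup>+\<theta>\<in>{0..2*pi}. indicator S (rot i j \<theta> ** y) * ennreal (\<rho> \<theta>) \<partial>lborel) * ?c"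
    by (simp add: sum_distrib_right case_prod_unfold)
  also have "?c = inverse (of_nat (CARD('n) choose 2))"
  proof -
    have "of_nat (CARD('n) choose 2) = ennreal num_planes"
      by (simp add: num_planes_def ennreal_of_nat_eq_real_of_nat)
    then show ?thesis by (simp only: inverse_ennreal[OF num_planes_pos] inverse_eq_divide)
  qed
  finally show ?thesis
    by (simp add: emeasure_kac_kernel[OF density S] divide_ennreal_def)
qed

lemma sets_kac_kernel [simp]: "sets (kac_kernel \<rho> x) = sets (borel_SO :: (real^'n::_^'n::_) measure)"
  and space_kac_kernel: "space (kac_kernel \<rho> x) = (SO :: (real^'n::_^'n::_) set)"
proof -
  have "sets (borel_SO :: (real^'n::_^'n::_) measure) \<subseteq> Pow SO"
    using sets.space_closed[of borel_SO] by simp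
  then show "sets (kac_kernel \<rho> x) = sets (borel_SO :: (real^'n::_^'n::_) measure)"
    "space (kac_kernel \<rho> x) = (SO :: (real^'n::_^'n::_) set)"
    using sets.sigma_sets_eq[of "borel_SO :: (real^'n::_^'n::_) measure"]
    by (simp_all add: kac_kernel_def space_measure_of_conv)
qed

lemma steps_act_measurable:
  assumes f [measurable]: "f \<in> M \<rightarrow>\<^sub>M borel_SO"
    and d: "\<And>p. (\<lambda>\<omega>. d p \<omega>) \<in> borel_measurable M"
  shows "(\<lambda>(\<omega>, p, \<theta>). turn p (d p \<omega>) \<theta> ** f \<omega>) \<in> M \<Otimes>\<^sub>M steps \<rightarrow>\<^sub>M (borel_SO :: (real^'n::_^'n::_) measure)"
  unfolding measurable_borel_SO_iff
proof
  have f_borel [measurable]: "f \<in> borel_measurable M" by (rule measurable_borel_SO_D[OF f])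
  have "(\<lambda>z. turn p (d p (fst z)) (snd (snd z)) ** f (fst z)) \<in> borel_measurable (M \<Otimes>\<^sub>M steps)" for p
    using d[of p] by measurable
  moreover have "(\<lambda>z. fst (snd z)) \<in> M \<Otimes>\<^sub>M steps \<rightarrow>\<^sub>M count_space UNIV" by measurable
  \<comment> \<open>There are finitely many values of the discrete component, so measurability for
    each fixed one suffices.\<close>
  ultimately have "(\<lambda>z. turn (fst (snd z)) (d (fst (snd z)) (fst z)) (snd (snd z)) ** f (fst z)) \<in> borel_measurable (M \<Otimes>\<^sub>M steps)"
    by (rule measurable_compose_countable)
  then show "(\<lambda>(\<omega>, p, \<theta>). turn p (d p \<omega>) \<theta> ** f \<omega>) \<in> borel_measurable (M \<Otimes>\<^sub>M steps)"
    by (simp add: case_prod_unfold)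
  show "(\<lambda>(\<omega>, p, \<theta>). turn p (d p \<omega>) \<theta> ** f \<omega>) \<in> space (M \<Otimes>\<^sub>M steps) \<rightarrow> SO"
    using measurable_space[OF f] by (auto simp: space_pair_measure intro!: SO_mult turn_SO)
qed

text \<open>For a fixed sample point the shift depends on \<open>p\<close> only and is invisible by
  \<open>kac_kernel_eq_steps\<close>; Fubini does the rest. With zero shifts the second claim gives
  measurability of the kernel.\<close>

lemma nn_integral_steps_act:
  assumes f [measurable]: "f \<in> M \<rightarrow>\<^sub>M borel_SO"
    and d: "\<And>p. (\<lambda>\<omega>. d p \<omega>) \<in> borel_measurable M" and S: "S \<in> sets (borel_SO :: (real^'n::_^'n::_) measure)"
  shows "(\<integral>\<^sup>+\<omega>. emeasure (kac_kernel \<rho> (f \<omega>)) S \<partial>M) =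
      (\<integral>\<^sup>+(\<omega>, p, \<theta>). indicator S (turn p (d p \<omega>) \<theta> ** f \<omega>) \<partial>(M \<Otimes>\<^sub>M steps))"
    and "(\<lambda>\<omega>. emeasure (kac_kernel \<rho> (f \<omega>)) S) \<in> borel_measurable M"
proof -
  interpret steps: prob_space steps by (rule prob_space_steps)
  have m: "(\<lambda>(\<omega>, p, \<theta>). indicator S (turn p (d p \<omega>) \<theta> ** f \<omega>) :: ennreal) \<in> borel_measurable (M \<Otimes>\<^sub>M steps)"
    using measurable_compose[OF steps_act_measurable[OF f d] borel_measurable_indicator[OF S]]
    by (simp add: case_prod_unfold)
  have eq: "(\<integral>\<^sup>+q. (case (\<omega>, q) of (\<omega>, p, \<theta>) \<Rightarrow> indicator S (turn p (d p \<omega>) \<theta> ** f \<omega>)) \<partial>steps) = emeasure (kac_kernel \<rho> (f \<omega>)) S"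
    if "\<omega> \<in> space M" for \<omega>
    using kac_kernel_eq_steps[of "f \<omega>" S "\<lambda>p. d p \<omega>"] measurable_space[OF f that] S by simp
  show "(\<integral>\<^sup>+\<omega>. emeasure (kac_kernel \<rho> (f \<omega>)) S \<partial>M) =
      (\<integral>\<^sup>+(\<omega>, p, \<theta>). indicator S (turn p (d p \<omega>) \<theta> ** f \<omega>) \<partial>(M \<Otimes>\<^sub>M steps))"
    unfolding steps.nn_integral_fst[OF m, symmetric]
    by (intro nn_integral_cong eq[symmetric])
  show "(\<lambda>\<omega>. emeasure (kac_kernel \<rho> (f \<omega>)) S) \<in> borel_measurable M"
    using steps.borel_measurable_nn_integral_fst[OF m]
    by (rule measurable_cong[THEN iffD1, rotated]) (rule eq)
qed

lemma kac_kernel_measurable: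
  "kac_kernel \<rho> \<in> borel_SO \<rightarrow>\<^sub>M subprob_algebra (borel_SO :: (real^'n::_^'n::_) measure)"
proof (rule measurable_subprob_algebra)
  fix x :: "real^'n::_^'n::_"
  assume "x \<in> space borel_SO"
  then have x: "x \<in> SO" by simp
  interpret steps: prob_space steps by (rule prob_space_steps)
  have "emeasure (kac_kernel \<rho> x) SO = (\<integral>\<^sup>+(p, \<theta>). indicator SO (turn p 0 \<theta> ** x) \<partial>steps)"
    using kac_kernel_eq_steps[OF x, of SO "\<lambda>_. 0"] sets.top[of "borel_SO :: (real^'n::_^'n::_) measure"] by simp
  also have "\<dots> = 1"
    using steps.emeasure_space_1 x by (simp add: turn_SO SO_mult case_prod_unfold)
  finally show "subprob_space (kac_kernel \<rho> x)"
    by (intro subprob_spaceI) (auto simp: space_kac_kernel intro: exI[of _ "mat 1"])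
next
  fix S :: "(real^'n::_^'n::_) set"
  assume "S \<in> sets borel_SO"
  then show "(\<lambda>x. emeasure (kac_kernel \<rho> x) S) \<in> borel_measurable borel_SO"
    by (intro nn_integral_steps_act(2)[where d = "\<lambda>_ _. 0"]) simp_all
qed simp

text \<open>A random turn moves the law of \<open>f\<close> by one step of the walk even if its
  angle is shifted by an amount that depends on the past. This is why both ends of a compensated
  curve still perform the walk.\<close>

lemma distr_bind_kac_kernel:
  fixes f :: "'a \<Rightarrow> real^'n::_^'n::_"
  assumes M: "prob_space M" and f: "f \<in> M \<rightarrow>\<^sub>M borel_SO"
    and d: "\<And>p. (\<lambda>\<omega>. d p \<omega>) \<in> borel_measurable M"
  shows "distr M borel_SO f \<bind> kac_kernel \<rho> =
    distr (M \<Otimes>\<^sub>M steps) borel_SO (\<lambda>(\<omega>, p, \<theta>). turn p (d p \<omega>) \<theta> ** f \<omega>)"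
proof (rule measure_eqI)
  have ne: "space (distr M borel_SO f) \<noteq> {}"
    using mat_1_SO by (metis space_distr space_borel_SO empty_iff)
  have K: "kac_kernel \<rho> \<in> distr M borel_SO f \<rightarrow>\<^sub>M subprob_algebra borel_SO"
    using kac_kernel_measurable by simp
  show sets: "sets (distr M borel_SO f \<bind> kac_kernel \<rho>) =
      sets (distr (M \<Otimes>\<^sub>M steps) borel_SO (\<lambda>(\<omega>, p, \<theta>). turn p (d p \<omega>) \<theta> ** f \<omega>))"
    by (simp add: sets_bind[OF _ ne])
  fix S
  assume "S \<in> sets (distr M borel_SO f \<bind> kac_kernel \<rho>)"
  then have S: "S \<in> sets borel_SO" using sets by simp
  have "emeasure (distr M borel_SO f \<bind> kac_kernel \<rho>) S = (\<integral>\<^sup>+x. emeasure (kac_kernel \<rho> x) S \<partial>distr M borel_SO f)"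
    by (rule emeasure_bind[OF ne K S])
  also have "\<dots> = (\<integral>\<^sup>+\<omega>. emeasure (kac_kernel \<rho> (f \<omega>)) S \<partial>M)"
    using nn_integral_steps_act(2)[of "\<lambda>x. x" borel_SO "\<lambda>_ _. 0" S] S by (intro nn_integral_distr f) simp
  also have "\<dots> = (\<integral>\<^sup>+z. indicator S (case z of (\<omega>, p, \<theta>) \<Rightarrow> turn p (d p \<omega>) \<theta> ** f \<omega>) \<partial>(M \<Otimes>\<^sub>M steps))"
    using nn_integral_steps_act(1)[OF f d S] by (simp add: case_prod_unfold)
  also have "\<dots> = emeasure (distr (M \<Otimes>\<^sub>M steps) borel_SO (\<lambda>(\<omega>, p, \<theta>). turn p (d p \<omega>) \<theta> ** f \<omega>)) S"
    by (rule emeasure_distr_indicator[symmetric, OF steps_act_measurable[OF f d] S])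
  finally show "emeasure (distr M borel_SO f \<bind> kac_kernel \<rho>) S =
      emeasure (distr (M \<Otimes>\<^sub>M steps) borel_SO (\<lambda>(\<omega>, p, \<theta>). turn p (d p \<omega>) \<theta> ** f \<omega>)) S" .
qed

text \<open>For each fixed step the turn is a left translation, which preserves \<open>H\<close>;
  the order of integration is exchanged to use this.\<close>

lemma haar_invariant: "H \<bind> kac_kernel \<rho> = H"
proof (rule measure_eqI)
  interpret steps: prob_space steps by (rule prob_space_steps)
  interpret H: prob_space H using haar by (simp add: haar_prob_def borel_prob_def)
  interpret P: pair_prob_space H steps ..
  have sets_H: "sets H = sets borel_SO" using haar by (simp add: haar_prob_def borel_prob_def)
  have space_H: "space H = SO" using sets_eq_imp_space_eq[OF sets_H] by simp
  have K: "kac_kernel \<rho> \<in> H \<rightarrow>\<^sub>M subprob_algebra borel_SO"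
    using kac_kernel_measurable by (simp add: measurable_cong_sets[OF sets_H refl])
  show sets: "sets (H \<bind> kac_kernel \<rho>) = sets H"
    using sets_bind[of H "kac_kernel \<rho>" borel_SO] H.not_empty by (simp add: sets_H)
  fix S
  assume "S \<in> sets (H \<bind> kac_kernel \<rho>)"
  then have S: "S \<in> sets borel_SO" using sets sets_H by simp
  have id: "(\<lambda>x. x) \<in> H \<rightarrow>\<^sub>M borel_SO" by (simp add: measurable_ident_sets[OF sets_H])
  have m: "(\<lambda>(x, p, \<theta>). indicator S (turn p 0 \<theta> ** x) :: ennreal) \<in> borel_measurable (H \<Otimes>\<^sub>M steps)"
    using measurable_compose[OF steps_act_measurable[OF id, of "\<lambda>_ _. 0"] borel_measurable_indicator[OF S]]
    by (simp add: case_prod_unfold)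
  have "emeasure (H \<bind> kac_kernel \<rho>) S = (\<integral>\<^sup>+x. emeasure (kac_kernel \<rho> x) S \<partial>H)"
    by (rule emeasure_bind[OF H.not_empty K S])
  also have "\<dots> = (\<integral>\<^sup>+(x, p, \<theta>). indicator S (turn p 0 \<theta> ** x) \<partial>(H \<Otimes>\<^sub>M steps))"
    by (rule nn_integral_steps_act(1)[OF id _ S]) simp
  also have "\<dots> = (\<integral>\<^sup>+q. \<integral>\<^sup>+x. (case (x, q) of (x, p, \<theta>) \<Rightarrow> indicator S (turn p 0 \<theta> ** x)) \<partial>H \<partial>steps)"
    by (rule P.nn_integral_snd[symmetric, OF m])
  also have "\<dots> = (\<integral>\<^sup>+q. emeasure H S \<partial>steps)"
  proof (rule nn_integral_cong)
    fix q :: "'n step \<times> real"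
    obtain p \<theta> where q: "q = (p, \<theta>)" by (cases q)
    have mq: "(\<lambda>x. turn p 0 \<theta> ** x) \<in> H \<rightarrow>\<^sub>M borel_SO"
      using measurable_borel_SO_D[OF id] by (auto simp: measurable_borel_SO_iff space_H intro!: SO_mult turn_SO)
    have "emeasure (distr H borel_SO (\<lambda>x. turn p 0 \<theta> ** x)) S = (\<integral>\<^sup>+x. indicator S (turn p 0 \<theta> ** x) \<partial>H)"
      by (rule emeasure_distr_indicator[OF mq S])
    moreover have "distr H borel_SO (\<lambda>x. turn p 0 \<theta> ** x) = H"
      using haar turn_SO by (simp add: haar_prob_def)
    ultimately show "(\<integral>\<^sup>+x. (case (x, q) of (x, p, \<theta>) \<Rightarrow> indicator S (turn p 0 \<theta> ** x)) \<partial>H) = emeasure H S"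
      by (simp add: q)
  qed
  finally show "emeasure (H \<bind> kac_kernel \<rho>) S = emeasure H S"
    by (simp add: steps.emeasure_space_1)
qed

section \<open>Contraction of the mean energy\<close>

text \<open>The uniform part has mass at most 1, and in dimension at least 2 there is at least one
  plane.\<close>

lemma contraction_nonneg: "0 \<le> contraction"
proof -
  obtain i j :: 'n where ij: "i < j"
  proof -
    have "card {(i, j). i < (j::'n)} \<noteq> 0"
      using card_ordered_pairs[where 'n = 'n] num_planes_pos by (simp add: num_planes_def)
    then have "{(i, j). i < (j::'n)} \<noteq> {}" by (metis card.empty)
    then show thesis using that by auto
  qed
  have "2 * pi * \<rho>min \<le> 1"
    using nn_integral_weight(2)[OF ij, of False] num_planes_pos by (simp add: zero_le_divide_iff)
  moreover have "1 \<le> num_planes"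
    using num_planes_pos unfolding num_planes_def
    by (metis One_nat_def Suc_leI of_nat_0_less_iff of_nat_1 of_nat_le_iff)
  ultimately show ?thesis
    using num_planes_pos by (simp add: contraction_def)
qed

text \<open>One random step acts on the whole curve, with the shift growing along it. The ends move
  by \<open>distr_bind_kac_kernel\<close>, and averaging \<open>energy_step\<close> over all planes
  yields the factor.\<close>

lemma random_curve_step:
  fixes \<gamma> B :: "'a \<Rightarrow> real \<Rightarrow> real^'n::_^'n::_"
  assumes rc: "random_curve M \<gamma> B \<mu> \<nu> E" and E: "0 \<le> E"
  shows "random_curve (M \<Otimes>\<^sub>M steps)
    (\<lambda>(\<omega>, p, \<theta>) s. turn p (phase p (B \<omega>) s) \<theta> ** \<gamma> \<omega> s)
    (\<lambda>(\<omega>, p, \<theta>). step_velocity p \<theta> (B \<omega>))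
    (\<mu> \<bind> kac_kernel \<rho>) (\<nu> \<bind> kac_kernel \<rho>) (contraction * E)"
    (is "random_curve _ ?\<gamma> ?B _ _ _")
proof -
  interpret steps: prob_space steps by (rule prob_space_steps)
  interpret M: prob_space M using rc by (simp add: random_curve_def)
  interpret P: pair_prob_space M steps ..
  have curve: "SO_curve (\<gamma> \<omega>) (B \<omega>)" if "\<omega> \<in> space M" for \<omega>
    using rc that by (simp add: random_curve_def)
  have B: "(\<lambda>(\<omega>, s). B \<omega> s) \<in> borel_measurable (M \<Otimes>\<^sub>M borel)"
    using rc by (simp add: random_curve_def)
  have B_comp [measurable (raw)]: "(\<lambda>x. B (f x) (g x)) \<in> borel_measurable N"
    if [measurable]: "f \<in> N \<rightarrow>\<^sub>M M" "g \<in> borel_measurable N" for f g N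
    using measurable_compose[of "\<lambda>x. (f x, g x)" N "M \<Otimes>\<^sub>M borel", OF _ B] by simp
  have phase [measurable (raw)]: "(\<lambda>x. phase p (B (f x)) (g x)) \<in> borel_measurable N"
    if [measurable]: "f \<in> N \<rightarrow>\<^sub>M M" "g \<in> borel_measurable N" for f g N and p :: "'n step"
    unfolding phase_def primitive_def case_prod_unfold by measurable
  have vel [measurable (raw)]: "(\<lambda>x. step_velocity p (h x) (B (f x)) (g x)) \<in> borel_measurable N"
    if [measurable]: "f \<in> N \<rightarrow>\<^sub>M M" "g \<in> borel_measurable N" "h \<in> borel_measurable N"
    for f g h N and p :: "'n step"
    unfolding step_velocity_def turn_velocity_def case_prod_unfold by measurable
  have B': "(\<lambda>(z, s). ?B z s) \<in> borel_measurable ((M \<Otimes>\<^sub>M steps) \<Otimes>\<^sub>M borel)"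
  proof -
    have "(\<lambda>x. step_velocity p (snd (snd (fst x))) (B (fst (fst x))) (snd x)) \<in> borel_measurable ((M \<Otimes>\<^sub>M steps) \<Otimes>\<^sub>M borel)"
      for p :: "'n step" by measurable
    moreover have "(\<lambda>x. fst (snd (fst x))) \<in> (M \<Otimes>\<^sub>M steps) \<Otimes>\<^sub>M borel \<rightarrow>\<^sub>M count_space UNIV" by measurable
    ultimately have "(\<lambda>x. step_velocity (fst (snd (fst x))) (snd (snd (fst x))) (B (fst (fst x))) (snd x))
        \<in> borel_measurable ((M \<Otimes>\<^sub>M steps) \<Otimes>\<^sub>M borel)"
      by (rule measurable_compose_countable)
    then show ?thesis by (simp add: case_prod_unfold)
  qed
  have curve': "SO_curve (?\<gamma> z) (?B z)" if "z \<in> space (M \<Otimes>\<^sub>M steps)" for z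
  proof -
    obtain \<omega> p \<theta> where z: "z = (\<omega>, p, \<theta>)" by (cases z)
    with that have "\<omega> \<in> space M" by (simp add: space_pair_measure)
    from SO_curve_step[OF curve[OF this]] show ?thesis unfolding z prod.case .
  qed
  have ends: "(\<lambda>z. ?\<gamma> z t) \<in> M \<Otimes>\<^sub>M steps \<rightarrow>\<^sub>M borel_SO"
    "distr M borel_SO (\<lambda>\<omega>. \<gamma> \<omega> t) \<bind> kac_kernel \<rho> = distr (M \<Otimes>\<^sub>M steps) borel_SO (\<lambda>z. ?\<gamma> z t)"
    if "(\<lambda>\<omega>. \<gamma> \<omega> t) \<in> M \<rightarrow>\<^sub>M borel_SO" for t
  proof -
    have d: "(\<lambda>\<omega>. phase p (B \<omega>) t) \<in> borel_measurable M" for p :: "'n step" by measurable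
    show "(\<lambda>z. ?\<gamma> z t) \<in> M \<Otimes>\<^sub>M steps \<rightarrow>\<^sub>M borel_SO"
      using steps_act_measurable[OF that d] by (simp add: case_prod_unfold)
    show "distr M borel_SO (\<lambda>\<omega>. \<gamma> \<omega> t) \<bind> kac_kernel \<rho> = distr (M \<Otimes>\<^sub>M steps) borel_SO (\<lambda>z. ?\<gamma> z t)"
      using distr_bind_kac_kernel[OF M.prob_space_axioms that d] by (simp add: case_prod_unfold)
  qed
  have em: "(\<lambda>z. ennreal (energy (?B z))) \<in> borel_measurable (M \<Otimes>\<^sub>M steps)"
    using borel_measurable_energy[OF B'] curve' by (auto simp: SO_curve_def)
  have eM: "(\<lambda>\<omega>. ennreal (energy (B \<omega>))) \<in> borel_measurable M"
    using borel_measurable_energy[OF B] curve by (auto simp: SO_curve_def)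
  have inner: "(\<integral>\<^sup>+q. ennreal (energy (?B (\<omega>, q))) \<partial>steps) = ennreal (contraction * energy (B \<omega>))"
    if \<omega>: "\<omega> \<in> space M" for \<omega>
  proof -
    \<comment> \<open>The energy after the step does not depend on the angle, so angle 0 represents
      all.\<close>
    define g :: "'n step \<Rightarrow> real" where "g p = energy (step_velocity p 0 (B \<omega>))" for p
    have eq: "energy (step_velocity p \<theta> (B \<omega>)) = g p" if "fst (snd p) < snd (snd p)" for p \<theta>
      using that energy_step[OF curve[OF \<omega>]] unfolding g_def by (cases p) simp
    have wpos: "AE q in steps. fst (snd (fst q)) < snd (snd (fst q))"
      unfolding steps_def
      by (simp add: AE_density[OF borel_measurable_weight_pair])
        (auto simp: weight_def split: if_splits)
    have "(\<integral>\<^sup>+q. ennreal (energy (?B (\<omega>, q))) \<partial>steps) = (\<integral>\<^sup>+q. ennreal (g (fst q)) \<partial>steps)"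
      using wpos by (intro nn_integral_cong_AE) (auto elim!: eventually_mono simp: case_prod_unfold eq)
    also have "\<dots> = ennreal (\<Sum>(i, j)\<in>{(i, j). i < j}.
        (2 * pi * \<rho>min * g (True, i, j) + (1 - 2 * pi * \<rho>min) * g (False, i, j)) / num_planes)"
      by (rule nn_integral_steps_fst) (simp add: g_def energy_nonneg)
    also have "(\<Sum>(i, j)\<in>{(i, j). i < j}.
        (2 * pi * \<rho>min * g (True, i, j) + (1 - 2 * pi * \<rho>min) * g (False, i, j)) / num_planes) =
        (\<Sum>(i, j)\<in>{(i, j). i < (j::'n)}. energy (B \<omega>) / num_planes -
          2 * pi * \<rho>min / num_planes * (2 * entry_energy i j (B \<omega>)))"
    proof (intro sum.cong refl, clarify)
      fix i j :: 'n
      assume "i < j"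
      then show "(2 * pi * \<rho>min * g (True, i, j) + (1 - 2 * pi * \<rho>min) * g (False, i, j)) / num_planes =
          energy (B \<omega>) / num_planes - 2 * pi * \<rho>min / num_planes * (2 * entry_energy i j (B \<omega>))"
        unfolding g_def using num_planes_pos
        by (simp add: energy_step[OF curve[OF \<omega>]] field_simps)
    qed
    \<comment> \<open>Here the losses in all planes are summed to the full energy.\<close>
    also have "\<dots> = energy (B \<omega>) - 2 * pi * \<rho>min / num_planes * energy (B \<omega>)"
      unfolding case_prod_unfold sum_subtractf sum_distrib_left[symmetric, of "2 * pi * \<rho>min / num_planes"]
        sum_const_pairs[unfolded case_prod_unfold] sum_entry_energy[OF curve[OF \<omega>], unfolded case_prod_unfold] ..
    also have "\<dots> = contraction * energy (B \<omega>)"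
      by (simp add: contraction_def algebra_simps)
    finally show ?thesis .
  qed
  have "(\<integral>\<^sup>+z. ennreal (energy (?B z)) \<partial>(M \<Otimes>\<^sub>M steps)) = (\<integral>\<^sup>+\<omega>. \<integral>\<^sup>+q. ennreal (energy (?B (\<omega>, q))) \<partial>steps \<partial>M)"
    by (rule steps.nn_integral_fst[OF em, symmetric])
  also have "\<dots> = (\<integral>\<^sup>+\<omega>. ennreal contraction * ennreal (energy (B \<omega>)) \<partial>M)"
    by (intro nn_integral_cong) (simp only: inner ennreal_mult contraction_nonneg energy_nonneg)
  also have "\<dots> = ennreal contraction * (\<integral>\<^sup>+\<omega>. ennreal (energy (B \<omega>)) \<partial>M)"
    by (rule nn_integral_cmult[OF eM])
  also have "\<dots> \<le> ennreal contraction * ennreal E"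
    using rc by (intro mult_left_mono) (auto simp: random_curve_def)
  also have "\<dots> = ennreal (contraction * E)"
    using E contraction_nonneg by (simp add: ennreal_mult)
  finally have energy': "(\<integral>\<^sup>+z. ennreal (energy (?B z)) \<partial>(M \<Otimes>\<^sub>M steps)) \<le> ennreal (contraction * E)" .
  have m: "(\<lambda>\<omega>. \<gamma> \<omega> 0) \<in> M \<rightarrow>\<^sub>M borel_SO" "(\<lambda>\<omega>. \<gamma> \<omega> 1) \<in> M \<rightarrow>\<^sub>M borel_SO"
    and law: "distr M borel_SO (\<lambda>\<omega>. \<gamma> \<omega> 0) = \<mu>" "distr M borel_SO (\<lambda>\<omega>. \<gamma> \<omega> 1) = \<nu>"
    using rc by (auto simp: random_curve_def)
  show ?thesis
    unfolding random_curve_def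
    by (intro conjI ballI P.prob_space_axioms curve' B' ends(1)[OF m(1)] ends(1)[OF m(2)] energy'
        ends(2)[OF m(1), unfolded law, symmetric] ends(2)[OF m(2), unfolded law, symmetric])
qed

text \<open>The history of the walk is recorded in a stream, so that the probability spaces of all times
  have the same type.\<close>

lemma random_curve_iterate:
  assumes \<mu>: "borel_prob \<mu>"
  shows "\<exists>(M :: (((real^'n::_^'n::_) \<times> (real^'n::_^'n::_)) \<times> ('n step \<times> real) stream) measure) \<gamma> B.
    sets M = sets ((\<mu> \<Otimes>\<^sub>M H) \<Otimes>\<^sub>M stream_space steps) \<and>
    random_curve M \<gamma> B (kernel_iter \<mu> (kac_kernel \<rho>) t) H (contraction ^ t * (pi\<^sup>2 * CARD('n)))"
proof (induction t)
  case 0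
  let ?N = "(\<mu> \<Otimes>\<^sub>M H) \<Otimes>\<^sub>M stream_space steps"
  interpret steps: prob_space steps by (rule prob_space_steps)
  obtain q where q: "q \<in> space steps" using steps.not_empty by auto
  obtain \<gamma> B where rc: "random_curve (\<mu> \<Otimes>\<^sub>M H) \<gamma> B \<mu> H (pi\<^sup>2 * CARD('n))"
    using random_curve_initial[OF \<mu> haar] by blast
  \<comment> \<open>At time 0 no step has been made; an arbitrary constant stream fills the
    history.\<close>
  have "sconst q \<in> space (stream_space steps)"
    using q by (simp add: space_stream_space streams_iff_sset)
  then have "(\<lambda>z. (z, sconst q)) \<in> \<mu> \<Otimes>\<^sub>M H \<rightarrow>\<^sub>M ?N" by simp
  from random_curve_recode[OF rc this measurable_fst] show ?case
    by (intro exI[of _ "distr (\<mu> \<Otimes>\<^sub>M H) ?N (\<lambda>z. (z, sconst q))"]) auto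
next
  case (Suc t)
  let ?N = "(\<mu> \<Otimes>\<^sub>M H) \<Otimes>\<^sub>M stream_space steps"
  let ?E = "contraction ^ t * (pi\<^sup>2 * CARD('n))"
  from Suc.IH obtain M :: "(((real^'n::_^'n::_) \<times> (real^'n::_^'n::_)) \<times> ('n step \<times> real) stream) measure" and \<gamma> B
    where sets_M [measurable_cong]: "sets M = sets ?N"
      and rc: "random_curve M \<gamma> B (kernel_iter \<mu> (kac_kernel \<rho>) t) H ?E"
    by blast
  \<comment> \<open>The newest step becomes the head of the stream, so splitting off the head
    decodes it.\<close>
  have enc: "(\<lambda>(z, q). (fst z, q ## snd z)) \<in> M \<Otimes>\<^sub>M steps \<rightarrow>\<^sub>M ?N"
    unfolding case_prod_unfold by measurable
  have dec: "(\<lambda>z. ((fst z, stl (snd z)), shd (snd z))) \<in> ?N \<rightarrow>\<^sub>M M \<Otimes>\<^sub>M steps"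
    by measurable
  have "0 \<le> ?E" using contraction_nonneg by simp
  \<comment> \<open>The second marginal remains \<open>H\<close> because the walk preserves
    it.\<close>
  note rc' = random_curve_recode[OF random_curve_step[OF rc this] enc dec, unfolded haar_invariant]
  have sets': "sets (distr (M \<Otimes>\<^sub>M steps) ?N (\<lambda>(z, q). (fst z, q ## snd z))) = sets ?N" by simp
  show ?case
    unfolding kernel_iter.simps power_Suc mult.assoc
    by (rule exI, rule exI, rule exI, rule conjI[OF sets' rc']) auto
qed

lemma wasserstein2_kernel_iter:
  assumes "borel_prob \<mu>"
  shows "wasserstein2 riem_dist (kernel_iter \<mu> (kac_kernel \<rho>) t) H \<le> sqrt (contraction ^ t * (pi\<^sup>2 * CARD('n)))"
  using random_curve_iterate[OF assms, of t] contraction_nonneg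
  by (auto intro!: wasserstein2_le_random_curve)

section \<open>The mixing time\<close>

text \<open>The number of planes is at most half the squared dimension, and 1 - x is at most
  exp(-x). The resulting factor 2 in the exponent matches the square of the target ratio, since the
  energy bounds the squared distance.\<close>

lemma mixing_bound:
  assumes \<epsilon>: "0 < \<epsilon>" and t: "(real CARD('n))\<^sup>2 / (2 * pi * \<rho>min) * ln (pi * sqrt (real CARD('n)) / \<epsilon>) \<le> real t"
  shows "sqrt (contraction ^ t * (pi\<^sup>2 * CARD('n))) \<le> \<epsilon>"
proof -
  let ?n = "real CARD('n)"
  have n: "0 < ?n" by simp
  have planes: "2 * num_planes \<le> ?n\<^sup>2"
  proof -
    have "2 * num_planes = ?n * (?n - 1)"
      by (simp add: num_planes_def choose_two real_of_nat_div of_nat_diff Suc_leI)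
    then show ?thesis by (simp add: power2_eq_square algebra_simps)
  qed
  have "contraction \<le> exp (- (2 * pi * \<rho>min / num_planes))"
    using exp_ge_add_one_self[of "- (2 * pi * \<rho>min / num_planes)"] by (simp add: contraction_def)
  also have "\<dots> \<le> exp (- (2 * (2 * pi * \<rho>min) / ?n\<^sup>2))"
    using planes num_planes_pos pos n by (simp add: field_simps)
  finally have "contraction ^ t \<le> exp (- (2 * (2 * pi * \<rho>min) / ?n\<^sup>2)) ^ t"
    using contraction_nonneg by (rule power_mono)
  also have "\<dots> = exp (- (2 * (2 * pi * \<rho>min) / ?n\<^sup>2 * t))"
    by (simp add: exp_of_nat_mult[symmetric] mult.commute)
  also have "\<dots> \<le> exp (- (2 * ln (pi * sqrt ?n / \<epsilon>)))"
  proof -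
    have "ln (pi * sqrt ?n / \<epsilon>) \<le> 2 * pi * \<rho>min / ?n\<^sup>2 * t"
      using t pos n by (simp add: field_simps)
    then show ?thesis by simp
  qed
  also have "\<dots> = (\<epsilon> / (pi * sqrt ?n))\<^sup>2"
  proof -
    have "exp (- (2 * ln (pi * sqrt ?n / \<epsilon>))) = (exp (- ln (pi * sqrt ?n / \<epsilon>)))\<^sup>2"
      by (simp add: exp_double[symmetric])
    then show ?thesis using \<epsilon> n by (simp add: exp_minus inverse_eq_divide)
  qed
  also have "\<dots> = \<epsilon>\<^sup>2 / (pi\<^sup>2 * ?n)"
    using n by (simp add: power_divide power_mult_distrib)
  finally have "contraction ^ t * (pi\<^sup>2 * ?n) \<le> \<epsilon>\<^sup>2"
    using n by (simp add: field_simps)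
  then show ?thesis using \<epsilon> by (intro real_le_lsqrt) auto
qed

end

theorem theorem4:
  fixes \<rho> :: "real \<Rightarrow> real" and \<rho>min \<epsilon> :: real
    and H :: "(real^'n::{finite,linorder}^'n::_) measure"
  assumes "2 \<le> CARD('n)"
    and "prob_density_2pi \<rho>"
    and "\<rho>min \<in> \<rho> ` {0..2*pi}" and "\<forall>\<theta>\<in>{0..2*pi}. \<rho>min \<le> \<rho> \<theta>"
    and "0 < \<rho>min"
    and "haar_prob H"
    and "0 < \<epsilon>"
  shows "mixing_time (kac_kernel \<rho>) H \<epsilon> \<le>
    enat (nat \<lceil>(real CARD('n))\<^sup>2 / (2 * pi * \<rho>min) * ln (pi * sqrt (real CARD('n)) / \<epsilon>)\<rceil>)"
    (is "_ \<le> enat ?t")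
proof -
  interpret kac_walk \<rho> \<rho>min H
    using assms by unfold_locales auto
  \<comment> \<open>If the logarithm is negative, \<open>nat\<close> replaces the ceiling by 0,
    which is still at least the quantity required.\<close>
  have "sqrt (contraction ^ ?t * (pi\<^sup>2 * CARD('n))) \<le> \<epsilon>"
    by (intro mixing_bound assms(7)) linarith
  then have "wasserstein2 riem_dist (kernel_iter \<mu> (kac_kernel \<rho>) ?t) H \<le> \<epsilon>" if "borel_prob \<mu>" for \<mu>
    using wasserstein2_kernel_iter[OF that, of ?t] by linarith
  then show ?thesis
    unfolding mixing_time_def by (intro Inf_lower) blast
qed

end
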